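(* Let $\Omega$ be an exact centralizer on a reflexive K\"othe function space $X$. If $\Omega$ is not disjointly singular, then there exist a subspace $W$ of $X$ generated by a disjoint sequence and a constant $K$ such that, given vectors $u_1,\dots,u_n$ in $W$, there are vectors $z_1,\dots,z_n$ in $X$ with $\mathrm{supp}\,z_i\subset\mathrm{supp}\,u_i$ and $\|z_i\|\le K\|u_i\|$ such that for all scalars $\lambda_1,\dots,\lambda_n$ $$\Big\|\Omega\Big(\sum_{i=1}^n\lambda_iu_i\Big)-\sum_{i=1}^n\lambda_i\Omega(u_i)\Big\|\le K\left(\Big\|\sum_{i=1}^n\lambda_iu_i\Big\|+\Big\|\sum_{i=1}^n\lambda_iz_i\Big\|\right).$$
   Context: A K\"othe function space $X$ over a ($\sigma$-finite) measure space is a Banach space of classes of measurable functions, contained in the space $L_0$ of all measurable functions, such that $|f|\le|g|$, $f\in L_0$, $g\in X$ imply $f\in X$, $\|f\|\le\|g\|$. A centralizer on $X$ is a homogeneous map $\Omega:X\to L_0$ for which there is $C$ with $\Omega(ax)-a\Omega(x)\in X$ and $\|\Omega(ax)-a\Omega(x)\|_X\le C\|x\|_X\|a\|_\infty$ for all $a\in L_\infty$, $x\in X$ (it then automatically satisfies $\|\Omega(u+v)-\Omega(u)-\Omega(v)\|_X\le M(\|u\|+\|v\|)$ for some $M$). It is exact if $\Omega(ux)=u\Omega(x)$ for every $x\in X$ and every $u\in L_\infty$ taking only the values $\pm1$. A subspace generated by a disjoint sequence is the closed linear span of an infinite sequence of nonzero vectors with pairwise disjoint supports. $\Omega$ is trivial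 on a subspace $W$ if there are a linear map $\ell:W\to L_0$ and a constant $C$ with $\Omega x-\ell x\in X$ and $\|\Omega x-\ell x\|\le C\|x\|$ for all $x\in W$; it is disjointly singular if it is not trivial on any subspace generated by a disjoint sequence. *)

theory Defs
  imports "HOL-Probability.Essential_Supremum"
begin

text \<open>
  Classes of measurable functions are represented by their measurable representatives:
  a space of classes is a set of functions closed under equality almost everywhere, a
  map between such spaces is a map of functions preserving that equality, and
  identities between classes are stated almost everywhere.

  The scalar field has sort \<open>{real_normed_field, euclidean_space}\<close>. Both \<^typ>\<open>real\<close> and
  \<^typ>\<open>complex\<close> are instances, and by the classification of finite-dimensional normed
  fields over the reals they are the only ones up to isometric isomorphism.
\<close>

text \<open>
  Closure of \<open>X\<close> under equality almost everywhere and the invariance of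
  \<open>N\<close> are instances of the ideal property.
\<close>

locale koethe_function_space = sigma_finite_measure M
  for M :: "'a measure" +
  fixes X :: "('a \<Rightarrow> 'k::{real_normed_field, euclidean_space}) set"
    and N :: "('a \<Rightarrow> 'k) \<Rightarrow> real"
  assumes measurable: "X \<subseteq> borel_measurable M"
    and zero: "(\<lambda>t. 0) \<in> X"
    and add: "\<And>x y. x \<in> X \<Longrightarrow> y \<in> X \<Longrightarrow> (\<lambda>t. x t + y t) \<in> X"
    and scale: "\<And>c x. x \<in> X \<Longrightarrow> (\<lambda>t. c * x t) \<in> X"
    and norm_eq_zero: "\<And>x. x \<in> X \<Longrightarrow> N x = 0 \<longleftrightarrow> (AE t in M. x t = 0)"
    and norm_triangle: "\<And>x y. x \<in> X \<Longrightarrow> y \<in> X \<Longrightarrow> N (\<lambda>t. x t + y t) \<le> N x + N y"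
    and norm_scale: "\<And>c x. x \<in> X \<Longrightarrow> N (\<lambda>t. c * x t) = norm c * N x"
    and complete: "\<And>s. (\<forall>n. s n \<in> X) \<Longrightarrow>
          (\<forall>e>0. \<exists>k. \<forall>m\<ge>k. \<forall>n\<ge>k. N (\<lambda>t. s m t - s n t) < e) \<Longrightarrow>
          \<exists>x\<in>X. (\<lambda>n. N (\<lambda>t. s n t - x t)) \<longlonglongrightarrow> 0"
    and ideal: "\<And>f g. f \<in> borel_measurable M \<Longrightarrow> g \<in> X \<Longrightarrow>
          (AE t in M. norm (f t) \<le> norm (g t)) \<Longrightarrow> f \<in> X \<and> N f \<le> N g"

text \<open>
  Functionals are considered only through their values on \<open>V\<close>. They automatically agree
  on vectors at \<open>p\<close>-distance zero. Since vectors are functions on an arbitrary type,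
  the construction can be iterated to obtain the bidual.
\<close>

definition dual_space ::
    "('b \<Rightarrow> 'k::real_normed_field) set \<Rightarrow> (('b \<Rightarrow> 'k) \<Rightarrow> real) \<Rightarrow> (('b \<Rightarrow> 'k) \<Rightarrow> 'k) set" where
  "dual_space V p = {\<phi>.
     (\<forall>x\<in>V. \<forall>y\<in>V. \<phi> (\<lambda>t. x t + y t) = \<phi> x + \<phi> y) \<and>
     (\<forall>c. \<forall>x\<in>V. \<phi> (\<lambda>t. c * x t) = c * \<phi> x) \<and>
     (\<exists>C. \<forall>x\<in>V. norm (\<phi> x) \<le> C * p x)}"

definition dual_norm ::
    "('b \<Rightarrow> 'k::real_normed_field) set \<Rightarrow> (('b \<Rightarrow> 'k) \<Rightarrow> real) \<Rightarrow> (('b \<Rightarrow> 'k) \<Rightarrow> 'k) \<Rightarrow> real" where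
  "dual_norm V p \<phi> = (SUP x\<in>{x\<in>V. p x \<le> 1}. norm (\<phi> x))"

definition reflexive ::
    "('b \<Rightarrow> 'k::real_normed_field) set \<Rightarrow> (('b \<Rightarrow> 'k) \<Rightarrow> real) \<Rightarrow> bool" where
  "reflexive V p \<longleftrightarrow>
     (\<forall>\<Psi>\<in>dual_space (dual_space V p) (dual_norm V p).
        \<exists>x\<in>V. \<forall>\<phi>\<in>dual_space V p. \<Psi> \<phi> = \<phi> x)"

definition Linfty :: "'a measure \<Rightarrow> ('a \<Rightarrow> 'k::real_normed_field) set" where
  "Linfty M = {a \<in> borel_measurable M. esssup M (\<lambda>t. ereal (norm (a t))) < \<infinity>}"

definition Linfty_norm :: "'a measure \<Rightarrow> ('a \<Rightarrow> 'k::real_normed_field) \<Rightarrow> real" where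
  "Linfty_norm M a = real_of_ereal (esssup M (\<lambda>t. ereal (norm (a t))))"

definition centralizer ::
    "'a measure \<Rightarrow> ('a \<Rightarrow> 'k::real_normed_field) set \<Rightarrow> (('a \<Rightarrow> 'k) \<Rightarrow> real)
      \<Rightarrow> (('a \<Rightarrow> 'k) \<Rightarrow> ('a \<Rightarrow> 'k)) \<Rightarrow> bool" where
  "centralizer M X N \<Omega> \<longleftrightarrow>
     (\<forall>x\<in>X. \<Omega> x \<in> borel_measurable M) \<and>
     (\<forall>x\<in>X. \<forall>y\<in>X. (AE t in M. x t = y t) \<longrightarrow> (AE t in M. \<Omega> x t = \<Omega> y t)) \<and>
     (\<forall>c. \<forall>x\<in>X. AE t in M. \<Omega> (\<lambda>s. c * x s) t = c * \<Omega> x t) \<and>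
     (\<exists>C. \<forall>a\<in>Linfty M. \<forall>x\<in>X.
        (\<lambda>t. \<Omega> (\<lambda>s. a s * x s) t - a t * \<Omega> x t) \<in> X \<and>
        N (\<lambda>t. \<Omega> (\<lambda>s. a s * x s) t - a t * \<Omega> x t) \<le> C * N x * Linfty_norm M a)"

definition exact ::
    "'a measure \<Rightarrow> ('a \<Rightarrow> 'k::real_normed_field) set \<Rightarrow> (('a \<Rightarrow> 'k) \<Rightarrow> ('a \<Rightarrow> 'k)) \<Rightarrow> bool" where
  "exact M X \<Omega> \<longleftrightarrow>
     (\<forall>x\<in>X. \<forall>u\<in>Linfty M. (AE t in M. u t = 1 \<or> u t = - 1) \<longrightarrow>
        (AE t in M. \<Omega> (\<lambda>s. u s * x s) t = u t * \<Omega> x t))"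

definition disjoint_sequence ::
    "'a measure \<Rightarrow> ('a \<Rightarrow> 'k::real_normed_field) set \<Rightarrow> (nat \<Rightarrow> 'a \<Rightarrow> 'k) \<Rightarrow> bool" where
  "disjoint_sequence M X w \<longleftrightarrow>
     (\<forall>n. w n \<in> X \<and> \<not> (AE t in M. w n t = 0)) \<and>
     (\<forall>m n. m \<noteq> n \<longrightarrow>
        (AE t in M. t \<notin> support_on (space M) (w m) \<inter> support_on (space M) (w n)))"

definition closed_linear_span ::
    "('a \<Rightarrow> 'k::real_normed_field) set \<Rightarrow> (('a \<Rightarrow> 'k) \<Rightarrow> real) \<Rightarrow> (nat \<Rightarrow> 'a \<Rightarrow> 'k)
      \<Rightarrow> ('a \<Rightarrow> 'k) set" where
  "closed_linear_span X N w =
     {x\<in>X. \<forall>e>0. \<exists>n c. N (\<lambda>t. x t - (\<Sum>i<n. c i * w i t)) < e}"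

definition generated_by_disjoint_sequence ::
    "'a measure \<Rightarrow> ('a \<Rightarrow> 'k::real_normed_field) set \<Rightarrow> (('a \<Rightarrow> 'k) \<Rightarrow> real)
      \<Rightarrow> ('a \<Rightarrow> 'k) set \<Rightarrow> bool" where
  "generated_by_disjoint_sequence M X N W \<longleftrightarrow>
     (\<exists>w. disjoint_sequence M X w \<and> W = closed_linear_span X N w)"

definition linear_into_L0 ::
    "'a measure \<Rightarrow> ('a \<Rightarrow> 'k::real_normed_field) set \<Rightarrow> (('a \<Rightarrow> 'k) \<Rightarrow> ('a \<Rightarrow> 'k)) \<Rightarrow> bool" where
  "linear_into_L0 M W l \<longleftrightarrow>
     (\<forall>x\<in>W. l x \<in> borel_measurable M) \<and>
     (\<forall>x\<in>W. \<forall>y\<in>W. (AE t in M. x t = y t) \<longrightarrow> (AE t in M. l x t = l y t)) \<and>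
     (\<forall>x\<in>W. \<forall>y\<in>W. AE t in M. l (\<lambda>s. x s + y s) t = l x t + l y t) \<and>
     (\<forall>c. \<forall>x\<in>W. AE t in M. l (\<lambda>s. c * x s) t = c * l x t)"

definition trivial_on ::
    "'a measure \<Rightarrow> ('a \<Rightarrow> 'k::real_normed_field) set \<Rightarrow> (('a \<Rightarrow> 'k) \<Rightarrow> real)
      \<Rightarrow> (('a \<Rightarrow> 'k) \<Rightarrow> ('a \<Rightarrow> 'k)) \<Rightarrow> ('a \<Rightarrow> 'k) set \<Rightarrow> bool" where
  "trivial_on M X N \<Omega> W \<longleftrightarrow>
     (\<exists>l C. linear_into_L0 M W l \<and>
        (\<forall>x\<in>W. (\<lambda>t. \<Omega> x t - l x t) \<in> X \<and> N (\<lambda>t. \<Omega> x t - l x t) \<le> C * N x))"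

definition disjointly_singular ::
    "'a measure \<Rightarrow> ('a \<Rightarrow> 'k::real_normed_field) set \<Rightarrow> (('a \<Rightarrow> 'k) \<Rightarrow> real)
      \<Rightarrow> (('a \<Rightarrow> 'k) \<Rightarrow> ('a \<Rightarrow> 'k)) \<Rightarrow> bool" where
  "disjointly_singular M X N \<Omega> \<longleftrightarrow>
     (\<forall>W. generated_by_disjoint_sequence M X N W \<longrightarrow> \<not> trivial_on M X N \<Omega> W)"

end

theory Submission
  imports Defs
begin

text \<open>
  Let \<open>\<Omega>\<close> be trivial on the span of a disjoint sequence \<open>w\<close>, with linear approximation \<open>l\<close>, and let
  \<open>h = l (w n) / w n\<close> on the support of \<open>w n\<close>. Averaging \<open>l\<close> over changes of sign on the first
  supports makes it diagonal there, and exactness keeps the average as close to \<open>\<Omega>\<close> as \<open>l\<close> is. So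
  \<open>\<Omega> x - h x\<close> is bounded by a multiple of the norm of \<open>x\<close> after restriction to finitely many
  supports. Reflexivity gives the Fatou property, which removes the restriction, and
  \<open>z\<^sub>i = \<Omega> u\<^sub>i - h u\<^sub>i\<close> works because multiplication by \<open>h\<close> is linear and both terms vanish
  where \<open>u\<^sub>i\<close> does.
\<close>

text \<open>The map \<open>l\<close> is linear but carries no continuity, so it can be evaluated
  only at finite combinations of the \<open>w n\<close>. This forces the comparison of
  \<open>\<Omega>\<close> with \<open>h\<close> to start from truncated vectors: an element of the
  closed span, cut to finitely many supports, is such a combination. Averaging over all sign changes
  at once would require a limit or an invariant mean with values in the measurable functions. A
  finite mean is pure algebra, and two facts make it uniform: it keeps the constant of
  \<open>l\<close>, and it keeps the value of \<open>l (w n)\<close> on the support of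
  \<open>w n\<close>. Hence one \<open>h\<close> serves every truncation, although the averaged map
  changes with the truncation. Truncating \<open>x\<close> inside \<open>\<Omega>\<close> rather
  than outside costs the centralizer constant for indicators; the bound for
  \<open>\<Omega> x - h x\<close> is the sum of the two constants. Reflexivity speaks of functionals
  only. Norming functionals turn its conclusion back into an identity of functions and a bound on a
  norm, which is why a Hahn-Banach theorem is proved at the start.\<close>

section \<open>Hahn--Banach theorem\<close>

context koethe_function_space
begin

lemma in_borel: "x \<in> X \<Longrightarrow> x \<in> borel_measurable M"
  using measurable by auto

lemma AE_eq_in:
  assumes "x \<in> X" "f \<in> borel_measurable M" "AE t in M. f t = x t"
  shows "f \<in> X" "N f = N x"
proof -
  have "AE t in M. norm (f t) \<le> norm (x t)" "AE t in M. norm (x t) \<le> norm (f t)"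
    using assms(3) by (auto elim!: eventually_mono)
  then show "f \<in> X" "N f = N x"
    using ideal[of f x] ideal[of x f] assms in_borel by auto
qed

lemma N_AE_cong:
  "x \<in> X \<Longrightarrow> y \<in> X \<Longrightarrow> AE t in M. x t = y t \<Longrightarrow> N x = N y"
  using AE_eq_in(2)[OF _ in_borel, of y x] by simp

lemma N_zero: "N (\<lambda>t. 0) = 0"
  using norm_eq_zero[OF zero] by simp

lemma minus: "x \<in> X \<Longrightarrow> (\<lambda>t. - x t) \<in> X"
  using scale[of x "-1"] by simp

lemma N_minus: "x \<in> X \<Longrightarrow> N (\<lambda>t. - x t) = N x"
  using norm_scale[of x "-1"] by simp

lemma diff: "x \<in> X \<Longrightarrow> y \<in> X \<Longrightarrow> (\<lambda>t. x t - y t) \<in> X"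
  using add[OF _ minus, of x y] by simp

lemma N_diff: "x \<in> X \<Longrightarrow> y \<in> X \<Longrightarrow> N (\<lambda>t. x t - y t) \<le> N x + N y"
  using norm_triangle[OF _ minus, of x y] N_minus[of y] by simp

lemma N_nonneg: "x \<in> X \<Longrightarrow> 0 \<le> N x"
  using N_diff[of x x] N_zero by simp

lemma sum_in: "finite I \<Longrightarrow> (\<And>i. i \<in> I \<Longrightarrow> x i \<in> X) \<Longrightarrow> (\<lambda>t. \<Sum>i\<in>I. x i t) \<in> X"
  by (induction I rule: finite_induct) (auto simp: zero intro!: add)

lemma mult_bounded:
  assumes "x \<in> X" "a \<in> borel_measurable M" "\<And>t. t \<in> space M \<Longrightarrow> norm (a t) \<le> 1"
  shows "(\<lambda>t. a t * x t) \<in> X" "N (\<lambda>t. a t * x t) \<le> N x"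
proof -
  have [measurable]: "a \<in> borel_measurable M" "x \<in> borel_measurable M"
    using assms in_borel by auto
  have "(\<lambda>t. a t * x t) \<in> X \<and> N (\<lambda>t. a t * x t) \<le> N x"
    using assms by (intro ideal) (auto simp: norm_mult intro!: mult_left_le_one_le)
  then show "(\<lambda>t. a t * x t) \<in> X" "N (\<lambda>t. a t * x t) \<le> N x" by auto
qed

lemma indicator_in:
  assumes "x \<in> X" "A \<in> sets M"
  shows "(\<lambda>t. indicator A t * x t) \<in> X" "N (\<lambda>t. indicator A t * x t) \<le> N x"
  using mult_bounded[OF assms(1), of "indicator A"] assms(2) by (auto simp: indicator_def)

text \<open>Only nonnegative real scalars, embedded by \<open>of_real\<close>: the extension
  argument is run over the reals and the field is brought in afterwards. Homogeneity is required as
  an inequality because that is what passes easily to infima; \<open>sublinear_scale\<close>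
  recovers equality.\<close>

definition sublinear :: "(('a \<Rightarrow> 'k) \<Rightarrow> real) \<Rightarrow> bool" where
  "sublinear q \<longleftrightarrow>
     (\<forall>x\<in>X. \<forall>y\<in>X. q (\<lambda>t. x t + y t) \<le> q x + q y) \<and>
     (\<forall>r\<ge>0. \<forall>x\<in>X. q (\<lambda>t. of_real r * x t) \<le> r * q x)"

lemma sublinearD:
  assumes "sublinear q"
  shows "x \<in> X \<Longrightarrow> y \<in> X \<Longrightarrow> q (\<lambda>t. x t + y t) \<le> q x + q y"
    and "0 \<le> r \<Longrightarrow> x \<in> X \<Longrightarrow> q (\<lambda>t. of_real r * x t) \<le> r * q x"
  using assms by (auto simp: sublinear_def)

lemma sublinear_zero: "sublinear q \<Longrightarrow> q (\<lambda>t. 0) = 0"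
  using sublinearD(1)[of q "\<lambda>t. 0" "\<lambda>t. 0"] sublinearD(2)[of q 0 "\<lambda>t. 0"] zero by simp

lemma sublinear_scale:
  assumes "sublinear q" "0 \<le> r" "x \<in> X"
  shows "q (\<lambda>t. of_real r * x t) = r * q x"
proof (cases "r = 0")
  case True
  then show ?thesis using sublinear_zero assms by simp
next
  case False
  then have "q (\<lambda>t. of_real (1 / r) * (of_real r * x t)) \<le> 1 / r * q (\<lambda>t. of_real r * x t)"
    using assms by (intro sublinearD scale) auto
  moreover have "(\<lambda>t. of_real (1 / r) * (of_real r * x t)) = x"
    using False by (auto simp: of_real_divide)
  ultimately have "r * q x \<le> q (\<lambda>t. of_real r * x t)"
    using False assms(2) by (simp add: field_simps)
  then show ?thesis using sublinearD(2)[OF assms] by simp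
qed

lemma sublinear_lower: "sublinear q \<Longrightarrow> x \<in> X \<Longrightarrow> - q (\<lambda>t. - x t) \<le> q x"
  using sublinearD(1)[of q x "\<lambda>t. - x t"] sublinear_zero[of q] minus[of x] by simp

lemma sublinear_norm: "sublinear N"
  unfolding sublinear_def using norm_triangle norm_scale by auto

text \<open>The tool that forces linearity. The infimum of \<open>q (x + s y) - s q y\<close> over
  nonnegative \<open>s\<close> is again sublinear: for a sum, add the two parameters. It is finite
  because \<open>- q (- x)\<close> is a lower bound; the parameters 0 and 1 give the last two
  claims.\<close>

lemma sublinear_shift:
  assumes q: "sublinear q" and y: "y \<in> X"
  obtains q' where "sublinear q'" "\<And>x. x \<in> X \<Longrightarrow> q' x \<le> q x" "q' (\<lambda>t. - y t) \<le> - q y"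
proof
  define g where "g x s = q (\<lambda>t. x t + of_real s * y t) - s * q y" for x s
  define q' where "q' x = (INF s\<in>{0..}. g x s)" for x
  have in_X: "(\<lambda>t. x t + of_real s * y t) \<in> X" if "x \<in> X" for x s
    using that y by (intro add scale)
  have bdd: "bdd_below (g x ` {0..})" if x: "x \<in> X" for x
  proof (rule bdd_belowI2)
    fix s :: real assume "s \<in> {0..}"
    then have "s * q y = q (\<lambda>t. of_real s * y t)" using sublinear_scale[OF q _ y] by simp
    also have "\<dots> = q (\<lambda>t. (x t + of_real s * y t) + - x t)" by simp
    also have "\<dots> \<le> q (\<lambda>t. x t + of_real s * y t) + q (\<lambda>t. - x t)"
      by (rule sublinearD(1)[OF q in_X[OF x] minus[OF x]])
    finally show "- q (\<lambda>t. - x t) \<le> g x s" by (simp add: g_def)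
  qed
  have le: "q' x \<le> g x s" if "x \<in> X" "0 \<le> s" for x s
    unfolding q'_def using that by (intro cINF_lower bdd) auto
  have greatest: "b \<le> q' x" if "\<And>s. 0 \<le> s \<Longrightarrow> b \<le> g x s" for b x
    unfolding q'_def using that by (intro cINF_greatest) auto
  show "sublinear q'" unfolding sublinear_def
  proof (intro conjI ballI allI impI)
    fix x z assume xz: "x \<in> X" "z \<in> X"
    have "q' (\<lambda>t. x t + z t) - g x s \<le> g z r" if "0 \<le> s" "0 \<le> r" for s r
    proof -
      have "q' (\<lambda>t. x t + z t) \<le> g (\<lambda>t. x t + z t) (s + r)"
        using xz that by (intro le add) auto
      also have "\<dots> = q (\<lambda>t. (x t + of_real s * y t) + (z t + of_real r * y t)) - (s + r) * q y"
        by (simp add: g_def algebra_simps)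
      also have "\<dots> \<le> g x s + g z r"
        using sublinearD(1)[OF q in_X[OF xz(1), of s] in_X[OF xz(2), of r]]
        by (simp add: g_def algebra_simps)
      finally show ?thesis by simp
    qed
    then have "q' (\<lambda>t. x t + z t) - g x s \<le> q' z" if "0 \<le> s" for s
      using that by (intro greatest)
    then have "q' (\<lambda>t. x t + z t) - q' z \<le> q' x"
      by (intro greatest) (simp add: algebra_simps)
    then show "q' (\<lambda>t. x t + z t) \<le> q' x + q' z" by simp
  next
    fix r :: real and x assume r: "0 \<le> r" and x: "x \<in> X"
    show "q' (\<lambda>t. of_real r * x t) \<le> r * q' x"
    proof (cases "r = 0")
      case True
      have "q' (\<lambda>t. 0) \<le> g (\<lambda>t. 0) 0" by (intro le zero) auto
      also have "\<dots> = 0" using sublinear_zero[OF q] by (simp add: g_def)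
      finally show ?thesis using True by simp
    next
      case False
      have "q' (\<lambda>t. of_real r * x t) / r \<le> g x s" if "0 \<le> s" for s
      proof -
        have "q' (\<lambda>t. of_real r * x t) \<le> g (\<lambda>t. of_real r * x t) (r * s)"
          using r x that by (intro le scale) auto
        also have "\<dots> = q (\<lambda>t. of_real r * (x t + of_real s * y t)) - r * s * q y"
          by (simp add: g_def algebra_simps)
        also have "\<dots> \<le> r * g x s"
          using sublinearD(2)[OF q r in_X[OF x, of s]] by (simp add: g_def algebra_simps)
        finally show ?thesis using False r by (simp add: field_simps)
      qed
      then have "q' (\<lambda>t. of_real r * x t) / r \<le> q' x" by (rule greatest)
      then show ?thesis using False r by (simp add: field_simps)
    qed
  qed
  show "q' x \<le> q x" if "x \<in> X" for x
    using le[OF that, of 0] by (simp add: g_def)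
  show "q' (\<lambda>t. - y t) \<le> - q y"
    using le[OF minus[OF y], of 1] sublinear_zero[OF q] by (simp add: g_def)
qed

text \<open>Zorn's lemma for the pointwise order: the pointwise infimum of a chain is sublinear, and
  the bound by \<open>p\<close> keeps it above \<open>- p (- x)\<close>.\<close>

lemma minimal_sublinear:
  assumes p: "sublinear p"
  obtains f where "sublinear f" "\<And>x. x \<in> X \<Longrightarrow> f x \<le> p x"
    "\<And>q x. sublinear q \<Longrightarrow> (\<And>x. x \<in> X \<Longrightarrow> q x \<le> f x) \<Longrightarrow> x \<in> X \<Longrightarrow> q x = f x"
proof -
  \<comment> \<open>Values outside \<open>X\<close> are normalized to 0, so that functionals
    agreeing on \<open>X\<close> are equal and the order is antisymmetric.\<close>
  define Q where "Q = {q. sublinear q \<and> (\<forall>x\<in>X. q x \<le> p x) \<and> (\<forall>x. x \<notin> X \<longrightarrow> q x = 0)}"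
  \<comment> \<open>The order is reversed, since Zorn's lemma delivers a maximal element and a
    minimal functional is wanted.\<close>
  define below where "below q r \<longleftrightarrow> (\<forall>x\<in>X. r x \<le> q x)" for q r :: "('a \<Rightarrow> 'k) \<Rightarrow> real"
  have cut: "(\<lambda>x. if x \<in> X then q x else 0) \<in> Q"
    if "sublinear q" "\<And>x. x \<in> X \<Longrightarrow> q x \<le> p x" for q
    using that by (auto simp: Q_def sublinear_def add scale)
  have "\<exists>f\<in>Q. \<forall>q\<in>Q. below f q \<longrightarrow> q = f"
  proof (rule predicate_Zorn)
    show "partial_order_on Q (relation_of below Q)"
    proof (rule partial_order_on_relation_ofI)
      show "q = r" if "q \<in> Q" "r \<in> Q" "below q r" "below r q" for q r
      proof
        show "q x = r x" for x
          using that by (cases "x \<in> X") (auto simp: Q_def below_def intro: antisym)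
      qed
    qed (auto simp: below_def intro: order_trans)
    fix C assume C: "C \<in> Chains (relation_of below Q)"
    have CQ: "C \<subseteq> Q" using C by (auto simp: Chains_def relation_of_def)
    have tot: "below q r \<or> below r q" if "q \<in> C" "r \<in> C" for q r
      using C that by (auto simp: Chains_def relation_of_def)
    show "\<exists>u\<in>Q. \<forall>q\<in>C. below q u"
    proof (cases "C = {}")
      case True
      then show ?thesis using cut[OF p] by auto
    next
      case False
      define u where "u x = (INF q\<in>C. q x)" for x
      have bdd: "bdd_below ((\<lambda>q. q x) ` C)" if x: "x \<in> X" for x
      proof (rule bdd_belowI2)
        fix q assume "q \<in> C"
        then have "sublinear q" "q (\<lambda>t. - x t) \<le> p (\<lambda>t. - x t)"
          using CQ minus[OF x] by (auto simp: Q_def)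
        then show "- p (\<lambda>t. - x t) \<le> q x" using sublinear_lower[of q x] x by simp
      qed
      have le: "u x \<le> q x" if "x \<in> X" "q \<in> C" for x q
        unfolding u_def using that by (intro cINF_lower bdd)
      have greatest: "b \<le> u x" if "\<And>q. q \<in> C \<Longrightarrow> b \<le> q x" for b x
        unfolding u_def using that False by (intro cINF_greatest) auto
      have "sublinear u" unfolding sublinear_def
      proof (intro conjI ballI allI impI)
        fix x y assume xy: "x \<in> X" "y \<in> X"
        \<comment> \<open>Two members of the chain may be nearly optimal for \<open>x\<close> and
          for \<open>y\<close>; the smaller of them, \<open>s\<close>, serves both.\<close>
        have "u (\<lambda>t. x t + y t) - q x \<le> r y" if qr: "q \<in> C" "r \<in> C" for q r
        proof -
          obtain s where s: "s \<in> C" "below q s" "below r s"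
            using tot[OF qr] qr by (auto simp: below_def)
          have "u (\<lambda>t. x t + y t) \<le> s (\<lambda>t. x t + y t)" using le add xy s by blast
          also have "\<dots> \<le> s x + s y" using s CQ xy by (intro sublinearD) (auto simp: Q_def)
          also have "\<dots> \<le> q x + r y" using s xy by (auto simp: below_def intro!: add_mono)
          finally show ?thesis by simp
        qed
        then have "u (\<lambda>t. x t + y t) - q x \<le> u y" if "q \<in> C" for q
          using that by (intro greatest)
        then have "u (\<lambda>t. x t + y t) - u y \<le> u x"
          by (intro greatest) (simp add: algebra_simps)
        then show "u (\<lambda>t. x t + y t) \<le> u x + u y" by simp
      next
        fix r :: real and x assume r: "0 \<le> r" and x: "x \<in> X"
        have bound: "u (\<lambda>t. of_real r * x t) \<le> r * q x" if "q \<in> C" for q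
          using le[OF scale[OF x, of "of_real r"] that] sublinearD(2)[of q, OF _ r x] CQ that
          by (force simp: Q_def)
        show "u (\<lambda>t. of_real r * x t) \<le> r * u x"
        proof (cases "r = 0")
          case True
          then show ?thesis using bound False by auto
        next
          case False
          then have "u (\<lambda>t. of_real r * x t) / r \<le> u x"
            using bound r by (intro greatest) (simp add: field_simps)
          then show ?thesis using False r by (simp add: field_simps)
        qed
      qed
      moreover have "u x \<le> p x" if "x \<in> X" for x
        using le[OF that] False CQ that by (force simp: Q_def)
      ultimately show ?thesis
        using cut[of u] le by (intro bexI[of _ "\<lambda>x. if x \<in> X then u x else 0"]) (auto simp: below_def)
    qed
  qed
  then obtain f where f: "f \<in> Q" "\<And>q. q \<in> Q \<Longrightarrow> below f q \<Longrightarrow> q = f" by blast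
  show thesis
  proof
    show "sublinear f" "\<And>x. x \<in> X \<Longrightarrow> f x \<le> p x" using f(1) by (auto simp: Q_def)
    fix q x assume q: "sublinear q" "\<And>x. x \<in> X \<Longrightarrow> q x \<le> f x" and x: "x \<in> X"
    have "(\<lambda>x. if x \<in> X then q x else 0) = f"
      using q f(1) by (intro f(2) cut) (auto simp: below_def Q_def intro: order_trans)
    then have "(if x \<in> X then q x else 0) = f x" by (rule fun_cong)
    then show "q x = f x" using x by simp
  qed
qed

text \<open>A minimal sublinear functional is linear: shifting it along \<open>y\<close> gives
  nothing smaller, so \<open>f (- y) = - f y\<close>, and an odd subadditive functional is additive.
  Shifting \<open>N\<close> along \<open>x0\<close> before minimizing forces the value at
  \<open>x0\<close>.\<close>

lemma real_Hahn_Banach: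
  assumes x0: "x0 \<in> X"
  obtains f where "\<And>x y. x \<in> X \<Longrightarrow> y \<in> X \<Longrightarrow> f (\<lambda>t. x t + y t) = f x + f y"
    "\<And>r x. x \<in> X \<Longrightarrow> f (\<lambda>t. of_real r * x t) = r * f x"
    "\<And>x. x \<in> X \<Longrightarrow> \<bar>f x\<bar> \<le> N x" "f x0 = N x0"
proof -
  obtain p where p: "sublinear p" "\<And>x. x \<in> X \<Longrightarrow> p x \<le> N x" "p (\<lambda>t. - x0 t) \<le> - N x0"
    using sublinear_shift[OF sublinear_norm x0] by blast
  obtain f where f: "sublinear f" "\<And>x. x \<in> X \<Longrightarrow> f x \<le> p x"
    "\<And>q x. sublinear q \<Longrightarrow> (\<And>x. x \<in> X \<Longrightarrow> q x \<le> f x) \<Longrightarrow> x \<in> X \<Longrightarrow> q x = f x"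
    using minimal_sublinear[OF p(1)] by blast
  have neg: "f (\<lambda>t. - y t) = - f y" if y: "y \<in> X" for y
  proof -
    obtain q where q: "sublinear q" "\<And>x. x \<in> X \<Longrightarrow> q x \<le> f x" "q (\<lambda>t. - y t) \<le> - f y"
      using sublinear_shift[OF f(1) y] by blast
    then have "f (\<lambda>t. - y t) \<le> - f y" using f(3)[OF q(1,2) minus[OF y]] by simp
    then show ?thesis using sublinear_lower[OF f(1) y] by simp
  qed
  have le: "f x \<le> N x" if "x \<in> X" for x using f(2) p(2) that order_trans by blast
  show thesis
  proof
    fix x y assume xy: "x \<in> X" "y \<in> X"
    have "- f (\<lambda>t. x t + y t) = f (\<lambda>t. - x t + - y t)"
      using neg[OF add[OF xy]] by simp
    also have "\<dots> \<le> - f x - f y"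
      using sublinearD(1)[OF f(1) minus[OF xy(1)] minus[OF xy(2)]] neg xy by simp
    finally show "f (\<lambda>t. x t + y t) = f x + f y"
      using sublinearD(1)[OF f(1) xy] by simp
  next
    fix r x assume x: "x \<in> X"
    show "f (\<lambda>t. of_real r * x t) = r * f x"
    proof (cases "0 \<le> r")
      case True
      then show ?thesis using sublinear_scale[OF f(1) _ x] by simp
    next
      case False
      then show ?thesis
        using sublinear_scale[OF f(1), of "- r" x] neg[OF scale[OF x, of "of_real r"]] x by simp
    qed
  next
    fix x assume "x \<in> X"
    then show "\<bar>f x\<bar> \<le> N x" using le[of x] le[OF minus, of x] neg N_minus by auto
  next
    show "f x0 = N x0"
      using le[OF x0] f(2)[OF minus[OF x0]] p(3) neg[OF x0] by simp
  qed
qed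

end

text \<open>By counting dimensions: the map from \<open>v\<close> to the functional is linear and injective.\<close>

lemma real_functional_eq_inner_mult:
  fixes g :: "'k::{real_normed_field, euclidean_space} \<Rightarrow> real"
  assumes "linear g"
  shows "\<exists>v. \<forall>b. g b = (b * v) \<bullet> 1"
proof -
  define L :: "'k \<Rightarrow> 'k" where "L v = (\<Sum>i\<in>Basis. ((i * v) \<bullet> 1) *\<^sub>R i)" for v
  have L: "b \<bullet> L v = (b * v) \<bullet> 1" for b v
  proof -
    have "b \<bullet> L v = (\<Sum>i\<in>Basis. ((i * v) \<bullet> 1) * (b \<bullet> i))"
      by (simp add: L_def inner_sum_right)
    also have "\<dots> = (\<Sum>i\<in>Basis. ((b \<bullet> i) *\<^sub>R i) * v) \<bullet> 1"
      by (simp add: inner_sum_left mult.commute[of "b \<bullet> _"])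
    also have "\<dots> = ((\<Sum>i\<in>Basis. (b \<bullet> i) *\<^sub>R i) * v) \<bullet> 1"
      by (simp only: sum_distrib_right)
    finally show ?thesis by (simp add: euclidean_representation)
  qed
  have lin: "linear L"
    by (rule linearI) (simp_all add: L_def algebra_simps inner_add_left sum.distrib scaleR_sum_right)
  moreover have "inj L"
  proof (subst linear_injective_0[OF lin], intro allI impI)
    fix v assume "L v = 0"
    then have "(inverse v * v) \<bullet> 1 = 0" using L[of "inverse v" v] by simp
    moreover have "(1::'k) \<bullet> 1 = 1" by (simp add: dot_square_norm)
    ultimately show "v = 0" by (cases "v = 0") auto
  qed
  ultimately have "surj L" by (rule linear_inj_imp_surj)
  then obtain v where v: "L v = (\<Sum>i\<in>Basis. g i *\<^sub>R i)" by (metis surjD)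
  have "g b = (b * v) \<bullet> 1" for b
  proof -
    have "g b = g (\<Sum>i\<in>Basis. (b \<bullet> i) *\<^sub>R i)" by (simp add: euclidean_representation)
    also have "\<dots> = b \<bullet> L v"
      using assms by (simp add: v linear_sum linear_scale inner_sum_right mult.commute)
    finally show ?thesis by (simp add: L)
  qed
  then show ?thesis by blast
qed

section \<open>Norming functionals over the scalar field\<close>

context koethe_function_space
begin

text \<open>Pairing with 1 plays the role of the real part. For each \<open>x\<close> the real
  functional sending \<open>b\<close> to \<open>f (b x)\<close> is represented by a unique scalar,
  taken as \<open>\<phi> x\<close>; uniqueness gives linearity over the field. For complex scalars
  this is the usual passage from a real functional to the complex one with that real part.\<close>

lemma Hahn_Banach:
  assumes x0: "x0 \<in> X"
  obtains \<phi> where "\<phi> \<in> dual_space X N" "\<And>x. x \<in> X \<Longrightarrow> norm (\<phi> x) \<le> N x" "N x0 \<le> norm (\<phi> x0)"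
proof -
  obtain f where f: "\<And>x y. x \<in> X \<Longrightarrow> y \<in> X \<Longrightarrow> f (\<lambda>t. x t + y t) = f x + f y"
    "\<And>r x. x \<in> X \<Longrightarrow> f (\<lambda>t. of_real r * x t) = r * f x"
    "\<And>x. x \<in> X \<Longrightarrow> \<bar>f x\<bar> \<le> N x" "f x0 = N x0"
    using real_Hahn_Banach[OF x0] by blast
  have one: "(1::'k) \<bullet> 1 = 1" by (simp add: dot_square_norm)
  have "\<exists>v. \<forall>b. f (\<lambda>t. b * x t) = (b * v) \<bullet> 1" if x: "x \<in> X" for x
  proof (rule real_functional_eq_inner_mult, rule linearI)
    fix b c :: 'k and r :: real
    show "f (\<lambda>t. (b + c) * x t) = f (\<lambda>t. b * x t) + f (\<lambda>t. c * x t)"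
      using f(1)[OF scale[OF x] scale[OF x], of b c] by (simp add: algebra_simps)
    show "f (\<lambda>t. r *\<^sub>R b * x t) = r *\<^sub>R f (\<lambda>t. b * x t)"
      using f(2)[OF scale[OF x], of r b] by (simp add: scaleR_conv_of_real mult.assoc)
  qed
  then obtain \<phi> where \<phi>: "\<And>x b. x \<in> X \<Longrightarrow> f (\<lambda>t. b * x t) = (b * \<phi> x) \<bullet> 1" by metis
  have uniq: "\<phi> x = v" if x: "x \<in> X" and v: "\<And>b. f (\<lambda>t. b * x t) = (b * v) \<bullet> 1" for x v
  proof (rule ccontr)
    assume "\<phi> x \<noteq> v"
    then have "(inverse (\<phi> x - v) * (\<phi> x - v)) \<bullet> 1 = 1" using one by simp
    moreover have "(inverse (\<phi> x - v) * (\<phi> x - v)) \<bullet> 1 = 0"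
      using \<phi>[OF x] v by (simp add: right_diff_distrib inner_diff_left)
    ultimately show False by simp
  qed
  have bound: "norm (\<phi> x) \<le> N x" if x: "x \<in> X" for x
  proof (cases "\<phi> x = 0")
    case True
    then show ?thesis using N_nonneg[OF x] by simp
  next
    case False
    \<comment> \<open>The scalar \<open>inverse (\<phi> x)\<close> rotates and rescales
      \<open>x\<close> so that the real functional sees the whole modulus of
      \<open>\<phi> x\<close>.\<close>
    then have "1 = f (\<lambda>t. inverse (\<phi> x) * x t)" using \<phi>[OF x] one by simp
    also have "\<dots> \<le> norm (inverse (\<phi> x)) * N x"
      using f(3)[OF scale[OF x], of "inverse (\<phi> x)"] norm_scale[OF x] by simp
    finally show ?thesis using False by (simp add: norm_inverse norm_divide field_simps)
  qed
  show thesis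
  proof
    have "\<phi> (\<lambda>t. x t + y t) = \<phi> x + \<phi> y" if "x \<in> X" "y \<in> X" for x y
      using that \<phi> f(1) scale
      by (intro uniq add) (auto simp: distrib_left inner_add_left)
    moreover have "\<phi> (\<lambda>t. c * x t) = c * \<phi> x" if "x \<in> X" for c x
      using that \<phi>[of x "_ * c"] by (intro uniq scale) (auto simp: mult.assoc)
    moreover have "\<exists>C. \<forall>x\<in>X. norm (\<phi> x) \<le> C * N x"
      using bound by (intro exI[of _ 1]) auto
    ultimately show "\<phi> \<in> dual_space X N" by (auto simp: dual_space_def)
    show "norm (\<phi> x) \<le> N x" if "x \<in> X" for x using bound[OF that] .
    have "N x0 = \<phi> x0 \<bullet> 1" using \<phi>[OF x0, of 1] f(4) by simp
    also have "\<dots> \<le> norm (\<phi> x0)" using norm_cauchy_schwarz[of "\<phi> x0" 1] by simp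
    finally show "N x0 \<le> norm (\<phi> x0)" .
  qed
qed

end

section \<open>The Fatou property of reflexive spaces\<close>

lemma dual_spaceD:
  assumes "\<phi> \<in> dual_space V p"
  shows "x \<in> V \<Longrightarrow> y \<in> V \<Longrightarrow> \<phi> (\<lambda>t. x t + y t) = \<phi> x + \<phi> y"
    and "x \<in> V \<Longrightarrow> \<phi> (\<lambda>t. c * x t) = c * \<phi> x"
    and "\<exists>C\<ge>0. \<forall>x\<in>V. norm (\<phi> x) \<le> C * \<bar>p x\<bar>"
proof -
  obtain C where C: "\<And>x. x \<in> V \<Longrightarrow> norm (\<phi> x) \<le> C * p x"
    using assms unfolding dual_space_def by blast
  have "norm (\<phi> x) \<le> \<bar>C\<bar> * \<bar>p x\<bar>" if "x \<in> V" for x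
    using C[OF that] abs_ge_self[of "C * p x"] by (simp add: abs_mult)
  then show "\<exists>C\<ge>0. \<forall>x\<in>V. norm (\<phi> x) \<le> C * \<bar>p x\<bar>" by (intro exI[of _ "\<bar>C\<bar>"]) auto
qed (use assms in \<open>auto simp: dual_space_def\<close>)

context koethe_function_space
begin

lemma dual_sum:
  assumes "\<phi> \<in> dual_space X N" "finite I" "\<And>i. i \<in> I \<Longrightarrow> x i \<in> X"
  shows "\<phi> (\<lambda>t. \<Sum>i\<in>I. x i t) = (\<Sum>i\<in>I. \<phi> (x i))"
  using assms(2,3)
proof (induction I rule: finite_induct)
  case empty
  then show ?case using dual_spaceD(2)[OF assms(1) zero, of 0] by simp
next
  case (insert i I)
  then show ?case
    using dual_spaceD(1)[OF assms(1), of "x i" "\<lambda>t. \<Sum>i\<in>I. x i t"] sum_in[of I x] by simp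
qed

lemma dual_minus:
  assumes "\<phi> \<in> dual_space X N" "x \<in> X" "y \<in> X"
  shows "\<phi> (\<lambda>t. x t - y t) = \<phi> x - \<phi> y"
  using dual_spaceD(1)[OF assms(1,2) minus[OF assms(3)]]
    dual_spaceD(2)[OF assms(1,3), of "-1"] by simp

lemma dual_eq_zero:
  assumes "\<phi> \<in> dual_space X N" "x \<in> X" "N x = 0"
  shows "\<phi> x = 0"
  using dual_spaceD(3)[OF assms(1)] assms by fastforce

lemma dual_AE_eq:
  assumes "\<phi> \<in> dual_space X N" "x \<in> X" "y \<in> X" "AE t in M. x t = y t"
  shows "\<phi> x = \<phi> y"
proof -
  have "N (\<lambda>t. x t - y t) = 0" using assms norm_eq_zero[OF diff, of x y] by auto
  then show ?thesis using dual_minus[OF assms(1-3)] dual_eq_zero[OF assms(1) diff] assms by simp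
qed

lemma dual_norm_upper:
  assumes \<phi>: "\<phi> \<in> dual_space X N" and x: "x \<in> X" "N x \<le> 1"
  shows "norm (\<phi> x) \<le> dual_norm X N \<phi>"
proof -
  obtain C where C: "0 \<le> C" "\<And>x. x \<in> X \<Longrightarrow> norm (\<phi> x) \<le> C * \<bar>N x\<bar>"
    using dual_spaceD(3)[OF \<phi>] by blast
  have "bdd_above ((\<lambda>x. norm (\<phi> x)) ` {x\<in>X. N x \<le> 1})"
  proof (rule bdd_aboveI2)
    fix x assume "x \<in> {x\<in>X. N x \<le> 1}"
    then show "norm (\<phi> x) \<le> C"
      using C(2)[of x] N_nonneg[of x] mult_left_le[of "N x" C] C(1) by auto
  qed
  then show ?thesis unfolding dual_norm_def using x by (intro cSUP_upper) auto
qed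

lemma dual_norm_nonneg: "\<phi> \<in> dual_space X N \<Longrightarrow> 0 \<le> dual_norm X N \<phi>"
  using dual_norm_upper[OF _ zero, of \<phi>] N_zero order_trans[OF norm_ge_zero[of "\<phi> (\<lambda>t. 0)"]]
  by simp

lemma dual_norm_bound:
  assumes \<phi>: "\<phi> \<in> dual_space X N" and x: "x \<in> X"
  shows "norm (\<phi> x) \<le> dual_norm X N \<phi> * N x"
proof (cases "N x = 0")
  case True
  then show ?thesis using dual_eq_zero[OF \<phi> x] by simp
next
  case False
  then have pos: "0 < N x" using N_nonneg[OF x] by simp
  have "norm (\<phi> (\<lambda>t. of_real (1 / N x) * x t)) \<le> dual_norm X N \<phi>"
    using norm_scale[OF x, of "of_real (1 / N x)"] pos
    by (intro dual_norm_upper \<phi> scale x) (simp add: norm_divide)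
  then have "norm (\<phi> x) / N x \<le> dual_norm X N \<phi>"
    using pos by (subst (asm) dual_spaceD(2)[OF \<phi> x]) (simp add: norm_mult norm_divide)
  then show ?thesis using pos by (simp add: pos_divide_le_eq)
qed

text \<open>Lets weak convergence be tested on one measurable set at a time.\<close>

lemma dual_indicator:
  assumes \<phi>: "\<phi> \<in> dual_space X N" and A: "A \<in> sets M"
  shows "(\<lambda>x. \<phi> (\<lambda>t. indicator A t * x t)) \<in> dual_space X N"
proof -
  obtain C where C: "0 \<le> C" "\<And>x. x \<in> X \<Longrightarrow> norm (\<phi> x) \<le> C * \<bar>N x\<bar>"
    using dual_spaceD(3)[OF \<phi>] by blast
  have "norm (\<phi> (\<lambda>t. indicator A t * x t)) \<le> C * N x" if x: "x \<in> X" for x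
    using C(2)[OF indicator_in(1)[OF x A]] mult_left_mono[OF indicator_in(2)[OF x A] C(1)]
      N_nonneg[OF indicator_in(1)[OF x A]] by simp
  moreover have "\<phi> (\<lambda>t. indicator A t * (x t + y t))
      = \<phi> (\<lambda>t. indicator A t * x t) + \<phi> (\<lambda>t. indicator A t * y t)" if "x \<in> X" "y \<in> X" for x y
    using dual_spaceD(1)[OF \<phi> indicator_in(1) indicator_in(1), OF that(1) A that(2) A]
    by (simp add: algebra_simps)
  moreover have "\<phi> (\<lambda>t. indicator A t * (c * x t)) = c * \<phi> (\<lambda>t. indicator A t * x t)"
    if "x \<in> X" for c x
    using dual_spaceD(2)[OF \<phi> indicator_in(1)[OF that A], of c] by (simp add: algebra_simps)
  ultimately show ?thesis by (auto simp: dual_space_def)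
qed

lemma indicator_UN_sum:
  fixes A :: "nat \<Rightarrow> 'a set"
  assumes "disjoint_family A"
  shows "indicator (\<Union>i<m. A i) t * y = (\<Sum>i<m. indicator (A i) t * (y::'k))"
  using assms by (subst indicator_UN_disjoint)
    (auto simp: sum_distrib_right disjoint_family_on_def)

text \<open>Multiplying the \<open>i\<close>-th piece by the phase \<open>norm a / a\<close> of \<open>a = \<phi> (1\<^bsub>A i\<^esub> y)\<close> turns
  the sum of the absolute values into one value of \<open>\<phi>\<close>.\<close>

lemma dual_sum_norm_le:
  fixes A :: "nat \<Rightarrow> 'a set"
  assumes \<phi>: "\<phi> \<in> dual_space X N"
    and A: "disjoint_family A" "\<And>i. A i \<in> sets M"
    and y: "(\<lambda>t. indicator (\<Union>i<m. A i) t * y t) \<in> X" (is "?y \<in> X")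
  shows "(\<Sum>i<m. norm (\<phi> (\<lambda>t. indicator (A i) t * y t)))
    \<le> dual_norm X N \<phi> * N (\<lambda>t. indicator (\<Union>i<m. A i) t * y t)"
proof -
  define a where "a i = \<phi> (\<lambda>t. indicator (A i) t * y t)" for i
  define \<theta> where "\<theta> i = (if a i = 0 then 0 else of_real (norm (a i)) / a i)" for i
  have \<theta>: "norm (\<theta> i) \<le> 1" "\<theta> i * a i = of_real (norm (a i))" for i
    by (auto simp: \<theta>_def norm_divide)
  have [simp]: "(\<lambda>t. indicator (A i) t * y t) \<in> X" if "i < m" for i
  proof -
    have "(\<lambda>t. indicator (A i) t * ?y t) = (\<lambda>t. indicator (A i) t * y t)"
      using that by (force simp: indicator_def)
    then show ?thesis using indicator_in(1)[OF y A(2), of i] by simp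
  qed
  define z where "z t = (\<Sum>i<m. \<theta> i * (indicator (A i) t * y t))" for t
  have z: "z \<in> X" unfolding z_def by (intro sum_in scale) auto
  have "norm (z t) \<le> norm (?y t)" for t
  proof -
    have "norm (z t) \<le> (\<Sum>i<m. norm (\<theta> i * (indicator (A i) t * y t)))"
      unfolding z_def by (rule norm_sum)
    also have "\<dots> \<le> (\<Sum>i<m. indicator (A i) t * norm (y t))"
      using \<theta>(1) by (intro sum_mono) (auto simp: norm_mult indicator_def intro: mult_left_le_one_le)
    also have "\<dots> = indicator (\<Union>i<m. A i) t * norm (y t)"
      using A(1) by (subst indicator_UN_disjoint)
        (auto simp: sum_distrib_right disjoint_family_on_def)
    also have "\<dots> = norm (?y t)" by (simp add: norm_mult indicator_def)
    finally show ?thesis .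
  qed
  then have Nz: "N z \<le> N ?y" using ideal[OF in_borel[OF z] y] by simp
  have "\<phi> z = (\<Sum>i<m. \<phi> (\<lambda>t. \<theta> i * (indicator (A i) t * y t)))"
    unfolding z_def by (intro dual_sum \<phi> scale) auto
  also have "\<dots> = (\<Sum>i<m. \<theta> i * a i)"
    unfolding a_def by (intro sum.cong refl dual_spaceD(2)[OF \<phi>]) auto
  also have "\<dots> = of_real (\<Sum>i<m. norm (a i))" by (simp add: \<theta>)
  finally have "norm (\<phi> z) = \<bar>\<Sum>i<m. norm (a i)\<bar>" by (simp only: norm_of_real)
  then have "(\<Sum>i<m. norm (a i)) = norm (\<phi> z)" by (simp add: sum_nonneg)
  also have "\<dots> \<le> dual_norm X N \<phi> * N z" by (rule dual_norm_bound[OF \<phi> z])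
  also have "\<dots> \<le> dual_norm X N \<phi> * N ?y"
    by (rule mult_left_mono[OF Nz dual_norm_nonneg[OF \<phi>]])
  finally show ?thesis by (simp add: a_def)
qed

text \<open>The truncations of \<open>y\<close> converge against every functional, because the
  values of a functional on the pieces are absolutely summable by \<open>dual_sum_norm_le\<close>.
  The limit is an element of the bidual bounded by \<open>R\<close>, hence given by some
  \<open>x\<close> in \<open>X\<close>. Localized functionals identify \<open>x\<close> with
  \<open>y\<close> on each \<open>A n\<close>, and a functional norming \<open>y\<close> carries the
  bound \<open>R\<close> to the limit.\<close>

lemma reflexive_Fatou:
  fixes A :: "nat \<Rightarrow> 'a set"
  assumes refl: "reflexive X N"
    and y: "y \<in> borel_measurable M"
    and A: "disjoint_family A" "\<And>i. A i \<in> sets M"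
    and y_in: "\<And>m. (\<lambda>t. indicator (\<Union>i<m. A i) t * y t) \<in> X"
    and y_le: "\<And>m. N (\<lambda>t. indicator (\<Union>i<m. A i) t * y t) \<le> R"
    and supp: "AE t in M. y t = indicator (\<Union>i. A i) t * y t"
  shows "y \<in> X" "N y \<le> R"
proof -
  define S where "S m t = indicator (\<Union>i<m. A i) t * y t" for m t
  have S: "S m \<in> X" "N (S m) \<le> R" for m using y_in y_le by (auto simp: S_def[abs_def])
  have S_eq: "S m t = (\<Sum>i<m. indicator (A i) t * y t)" for m t
    unfolding S_def by (rule indicator_UN_sum[OF A(1)])
  have A_y: "(\<lambda>t. indicator (A i) t * y t) \<in> X" for i
  proof -
    have "(\<lambda>t. indicator (A i) t * S (Suc i) t) = (\<lambda>t. indicator (A i) t * y t)"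
      by (force simp: indicator_def S_def)
    then show ?thesis using indicator_in(1)[OF S(1)[of "Suc i"] A(2), of i] by simp
  qed
  have \<phi>_S: "\<phi> (S m) = (\<Sum>i<m. \<phi> (\<lambda>t. indicator (A i) t * y t))" if "\<phi> \<in> dual_space X N" for \<phi> m
    unfolding S_eq[abs_def] using A_y that by (intro dual_sum) auto
  have conv: "convergent (\<lambda>m. \<phi> (S m))" if \<phi>: "\<phi> \<in> dual_space X N" for \<phi>
  proof -
    have "(\<Sum>i<m. norm (\<phi> (\<lambda>t. indicator (A i) t * y t))) \<le> dual_norm X N \<phi> * R" for m
      using dual_sum_norm_le[OF \<phi> A y_in[of m]] mult_left_mono[OF y_le[of m] dual_norm_nonneg[OF \<phi>]]
      by simp
    then have "summable (\<lambda>i. norm (\<phi> (\<lambda>t. indicator (A i) t * y t)))"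
      by (intro summableI_nonneg_bounded) auto
    then have "summable (\<lambda>i. \<phi> (\<lambda>t. indicator (A i) t * y t))" by (rule summable_norm_cancel)
    then show ?thesis
      unfolding \<phi>_S[OF \<phi>] by (simp add: summable_iff_convergent)
  qed
  \<comment> \<open>Outside the dual space \<open>lim\<close> may be an arbitrary value;
    \<open>dual_space\<close> constrains \<open>\<Psi>\<close> only on the dual of
    \<open>X\<close>.\<close>
  define \<Psi> where "\<Psi> \<phi> = lim (\<lambda>m. \<phi> (S m))" for \<phi> :: "('a \<Rightarrow> 'k) \<Rightarrow> 'k"
  have \<Psi>: "(\<lambda>m. \<phi> (S m)) \<longlonglongrightarrow> \<Psi> \<phi>" if "\<phi> \<in> dual_space X N" for \<phi>
    using conv[OF that] by (simp add: \<Psi>_def convergent_LIMSEQ_iff)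
  have "\<Psi> \<in> dual_space (dual_space X N) (dual_norm X N)"
    unfolding dual_space_def[of "dual_space X N"]
  proof (intro CollectI conjI ballI allI exI[of _ R])
    fix \<phi> \<eta> assume \<phi>: "\<phi> \<in> dual_space X N" and \<eta>: "\<eta> \<in> dual_space X N"
    show "\<Psi> (\<lambda>t. \<phi> t + \<eta> t) = \<Psi> \<phi> + \<Psi> \<eta>"
      unfolding \<Psi>_def[of "\<lambda>t. \<phi> t + \<eta> t"] by (intro limI tendsto_add \<Psi> \<phi> \<eta>)
  next
    fix c \<phi> assume \<phi>: "\<phi> \<in> dual_space X N"
    show "\<Psi> (\<lambda>t. c * \<phi> t) = c * \<Psi> \<phi>"
      unfolding \<Psi>_def[of "\<lambda>t. c * \<phi> t"] by (intro limI tendsto_mult_left \<Psi> \<phi>)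
  next
    fix \<phi> assume \<phi>: "\<phi> \<in> dual_space X N"
    have "norm (\<phi> (S m)) \<le> R * dual_norm X N \<phi>" for m
      using dual_norm_bound[OF \<phi> S(1)[of m]] mult_left_mono[OF S(2)[of m] dual_norm_nonneg[OF \<phi>]]
      by (simp add: mult.commute)
    then show "norm (\<Psi> \<phi>) \<le> R * dual_norm X N \<phi>"
      by (intro LIMSEQ_le_const2[OF tendsto_norm[OF \<Psi>[OF \<phi>]]]) auto
  qed
  then obtain x where x: "x \<in> X" "\<And>\<phi>. \<phi> \<in> dual_space X N \<Longrightarrow> \<Psi> \<phi> = \<phi> x"
    using refl by (auto simp: reflexive_def)
  have lim_x: "(\<lambda>m. \<phi> (S m)) \<longlonglongrightarrow> \<phi> x" if "\<phi> \<in> dual_space X N" for \<phi>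
    using \<Psi>[OF that] x(2)[OF that] by simp
  have x_eq: "AE t in M. indicator (A n) t * x t = indicator (A n) t * y t" for n
  proof -
    let ?v = "\<lambda>t. indicator (A n) t * x t - indicator (A n) t * y t"
    have v: "?v \<in> X" by (rule diff[OF indicator_in(1)[OF x(1) A(2)] A_y])
    obtain \<phi> where \<phi>: "\<phi> \<in> dual_space X N" "N ?v \<le> norm (\<phi> ?v)" by (rule Hahn_Banach[OF v])
    \<comment> \<open>After restriction to \<open>A n\<close> the truncations are constant from
      \<open>n + 1\<close> on, so their weak limit is known exactly.\<close>
    have "\<phi> (\<lambda>t. indicator (A n) t * S m t) = \<phi> (\<lambda>t. indicator (A n) t * y t)" if "n < m" for m
      using that by (intro arg_cong[of _ _ \<phi>] ext) (auto simp: S_def indicator_def)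
    then have "(\<lambda>m. \<phi> (\<lambda>t. indicator (A n) t * S m t)) \<longlonglongrightarrow> \<phi> (\<lambda>t. indicator (A n) t * y t)"
      by (intro tendsto_eventually eventually_sequentiallyI[of "Suc n"]) auto
    then have "\<phi> (\<lambda>t. indicator (A n) t * y t) = \<phi> (\<lambda>t. indicator (A n) t * x t)"
      using lim_x[OF dual_indicator[OF \<phi>(1) A(2)]] LIMSEQ_unique by blast
    then have "\<phi> ?v = 0" using dual_minus[OF \<phi>(1) indicator_in(1)[OF x(1) A(2)] A_y] by simp
    then have "N ?v = 0" using \<phi>(2) N_nonneg[OF v] by simp
    then show ?thesis using norm_eq_zero[OF v] by simp
  qed
  \<comment> \<open>Nothing has been shown about \<open>x\<close> off the sets \<open>A i\<close>,
    so it is cut to their union before being compared with \<open>y\<close>.\<close>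
  define B where "B = (\<Union>i. A i)"
  have B: "B \<in> sets M" using A by (auto simp: B_def)
  have y_eq: "AE t in M. y t = indicator B t * x t"
    using supp x_eq[THEN AE_all_countable[THEN iffD2, OF allI]]
    by eventually_elim (auto simp: indicator_def B_def split: if_splits)
  show y_X: "y \<in> X" using AE_eq_in[OF indicator_in(1)[OF x(1) B] y y_eq] by simp
  obtain \<phi> where \<phi>: "\<phi> \<in> dual_space X N" "\<And>x. x \<in> X \<Longrightarrow> norm (\<phi> x) \<le> N x" "N y \<le> norm (\<phi> y)"
    using Hahn_Banach[OF y_X] by blast
  have "(\<lambda>m. \<phi> (\<lambda>t. indicator B t * S m t)) \<longlonglongrightarrow> \<phi> (\<lambda>t. indicator B t * x t)"
    by (rule lim_x[OF dual_indicator[OF \<phi>(1) B]])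
  moreover have "(\<lambda>t. indicator B t * S m t) = S m" for m
    by (rule ext) (auto simp: S_def B_def indicator_def)
  moreover have "\<phi> (\<lambda>t. indicator B t * x t) = \<phi> y"
    using y_eq by (intro dual_AE_eq[OF \<phi>(1) indicator_in(1)[OF x(1) B] y_X]) auto
  ultimately have lim: "(\<lambda>m. \<phi> (S m)) \<longlonglongrightarrow> \<phi> y" by simp
  have "norm (\<phi> (S m)) \<le> R" for m using \<phi>(2)[OF S(1)] S(2) order_trans by blast
  then have "norm (\<phi> y) \<le> R" by (intro LIMSEQ_le_const2[OF tendsto_norm[OF lim]]) auto
  then show "N y \<le> R" using \<phi>(3) by simp
qed

end

section \<open>The span of a disjoint sequence\<close>

lemma Linfty_bounded:
  assumes "a \<in> borel_measurable M" "\<And>t. t \<in> space M \<Longrightarrow> norm (a t) \<le> 1"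
  shows "a \<in> Linfty M" "\<bar>Linfty_norm M a\<bar> \<le> 1"
proof -
  let ?e = "esssup M (\<lambda>t. ereal (norm (a t)))"
  have [measurable]: "a \<in> borel_measurable M" by fact
  have le: "?e \<le> 1" using assms by (intro esssup_I) auto
  then have "?e < \<infinity>" by (rule order_le_less_trans) simp
  then show "a \<in> Linfty M" using assms by (simp add: Linfty_def)
  \<comment> \<open>On a space of measure zero the essential supremum is minus infinity, which
    \<open>real_of_ereal\<close> sends to 0.\<close>
  have "?e = - \<infinity> \<or> 0 \<le> ?e"
  proof (cases "emeasure M (space M) = 0")
    case True
    then show ?thesis by (simp add: esssup_zero_space)
  next
    case False
    have "esssup M (\<lambda>t. 0::ereal) \<le> ?e" by (intro esssup_mono) auto
    then show ?thesis using esssup_const[OF False, of "0::ereal"] by simp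
  qed
  then show "\<bar>Linfty_norm M a\<bar> \<le> 1"
    using le by (cases ?e) (auto simp: Linfty_norm_def)
qed

lemma (in koethe_function_space) centralizer_bounded:
  assumes "centralizer M X N \<Omega>"
  obtains C where "0 \<le> C" "\<And>a x. a \<in> borel_measurable M \<Longrightarrow> (\<And>t. t \<in> space M \<Longrightarrow> norm (a t) \<le> 1) \<Longrightarrow>
    x \<in> X \<Longrightarrow> (\<lambda>t. \<Omega> (\<lambda>s. a s * x s) t - a t * \<Omega> x t) \<in> X \<and>
      N (\<lambda>t. \<Omega> (\<lambda>s. a s * x s) t - a t * \<Omega> x t) \<le> C * N x"
proof -
  obtain C where C: "\<And>a x. a \<in> Linfty M \<Longrightarrow> x \<in> X \<Longrightarrow>
      (\<lambda>t. \<Omega> (\<lambda>s. a s * x s) t - a t * \<Omega> x t) \<in> X \<and>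
      N (\<lambda>t. \<Omega> (\<lambda>s. a s * x s) t - a t * \<Omega> x t) \<le> C * N x * Linfty_norm M a"
    using assms unfolding centralizer_def by blast
  show thesis
  proof (rule that[of "\<bar>C\<bar>"])
    fix a :: "'a \<Rightarrow> 'k" and x assume a: "a \<in> borel_measurable M" "\<And>t. t \<in> space M \<Longrightarrow> norm (a t) \<le> 1" and x: "x \<in> X"
    note L = Linfty_bounded[OF a]
    have "C * N x * Linfty_norm M a \<le> \<bar>C * N x\<bar> * \<bar>Linfty_norm M a\<bar>"
      by (metis abs_ge_self abs_mult)
    also have "\<dots> \<le> \<bar>C\<bar> * N x"
      using mult_left_le[OF L(2), of "\<bar>C * N x\<bar>"] N_nonneg[OF x] by (simp add: abs_mult)
    finally show "(\<lambda>t. \<Omega> (\<lambda>s. a s * x s) t - a t * \<Omega> x t) \<in> X \<and>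
      N (\<lambda>t. \<Omega> (\<lambda>s. a s * x s) t - a t * \<Omega> x t) \<le> \<bar>C\<bar> * N x"
      using C[OF L(1) x] by auto
  qed simp
qed

text \<open>The sets \<open>A n\<close> are versions of the supports chosen so that exceptional null
  sets stay away from the definition of \<open>h\<close>: they are disjoint everywhere, and
  \<open>w n\<close> may be divided by at every point of \<open>A n\<close>. Only the vanishing of
  \<open>w n\<close> off \<open>A n\<close> is almost everywhere.\<close>

locale disjoint_vectors = koethe_function_space M X N
  for M :: "'a measure" and X :: "('a \<Rightarrow> 'k::{real_normed_field, euclidean_space}) set" and N +
  fixes w :: "nat \<Rightarrow> 'a \<Rightarrow> 'k" and A :: "nat \<Rightarrow> 'a set"
  assumes w_in: "w n \<in> X"
    and w_nonzero: "\<not> (AE t in M. w n t = 0)"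
    and A_sets: "A n \<in> sets M"
    and A_disjoint: "disjoint_family A"
    and w_on: "t \<in> A n \<Longrightarrow> w n t \<noteq> 0"
    and w_off: "AE t in M. t \<notin> A n \<longrightarrow> w n t = 0"
begin

abbreviation W where "W \<equiv> closed_linear_span X N w"

lemma A_eq: "t \<in> A i \<Longrightarrow> t \<in> A j \<Longrightarrow> i = j"
  using A_disjoint by (auto simp: disjoint_family_on_def)

lemma AE_w: "AE t in M. \<forall>n. t \<notin> A n \<longrightarrow> w n t = 0"
  using w_off by (simp add: AE_all_countable)

lemma W_in: "x \<in> W \<Longrightarrow> x \<in> X"
  by (simp add: closed_linear_span_def)

lemma span_in: "(\<lambda>t. \<Sum>i<n. c i * w i t) \<in> X"
  by (intro sum_in scale w_in) auto

lemma W_approx: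
  "x \<in> W \<Longrightarrow> 0 < e \<Longrightarrow> \<exists>n c. N (\<lambda>t. x t - (\<Sum>i<n. c i * w i t)) < e"
  by (simp add: closed_linear_span_def)

lemma W_intro:
  assumes "x \<in> X" "\<And>e. 0 < e \<Longrightarrow> \<exists>n c. N (\<lambda>t. x t - (\<Sum>i<n. c i * w i t)) < e"
  shows "x \<in> W"
  using assms by (simp add: closed_linear_span_def)

lemma span_in_W: "(\<lambda>t. \<Sum>i<n. c i * w i t) \<in> W"
proof (rule W_intro[OF span_in])
  fix e :: real assume "0 < e"
  then have "N (\<lambda>t. (\<Sum>i<n. c i * w i t) - (\<Sum>i<n. c i * w i t)) < e" by (simp add: N_zero)
  then show "\<exists>n' c'. N (\<lambda>t. (\<Sum>i<n. c i * w i t) - (\<Sum>i<n'. c' i * w i t)) < e" by blast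
qed

lemma w_in_W: "w n \<in> W"
proof -
  have "(\<Sum>i<Suc n. (if i = n then 1 else 0) * w i t) = w n t" for t
    by (simp add: if_distrib[of "\<lambda>x. x * _"] cong: if_cong)
  then show ?thesis using span_in_W[where n = "Suc n" and c = "\<lambda>i. if i = n then 1 else 0"] by simp
qed

lemma W_add:
  assumes "x \<in> W" "y \<in> W"
  shows "(\<lambda>t. x t + y t) \<in> W"
proof (rule W_intro[OF add[OF W_in[OF assms(1)] W_in[OF assms(2)]]])
  fix e :: real assume e: "0 < e"
  obtain n c where nc: "N (\<lambda>t. x t - (\<Sum>i<n. c i * w i t)) < e / 2"
    using W_approx[OF assms(1), of "e / 2"] e by force
  obtain m d where md: "N (\<lambda>t. y t - (\<Sum>i<m. d i * w i t)) < e / 2"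
    using W_approx[OF assms(2), of "e / 2"] e by force
  define c' where "c' i = (if i < n then c i else 0) + (if i < m then d i else 0)" for i
  have pad: "(\<Sum>i<max n m. (if i < k then f i else 0) * w i t) = (\<Sum>i<k. f i * w i t)"
    if "k \<le> max n m" for k f t
    using that by (intro sum.mono_neutral_cong_right) auto
  have "(\<Sum>i<max n m. c' i * w i t) = (\<Sum>i<n. c i * w i t) + (\<Sum>i<m. d i * w i t)" for t
    using pad[of n c t] pad[of m d t] by (simp add: c'_def distrib_right sum.distrib)
  then have "N (\<lambda>t. x t + y t - (\<Sum>i<max n m. c' i * w i t))
    = N (\<lambda>t. (x t - (\<Sum>i<n. c i * w i t)) + (y t - (\<Sum>i<m. d i * w i t)))"
    by (simp add: algebra_simps)
  also have "\<dots> \<le> N (\<lambda>t. x t - (\<Sum>i<n. c i * w i t)) + N (\<lambda>t. y t - (\<Sum>i<m. d i * w i t))"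
    by (intro norm_triangle diff W_in assms span_in)
  also have "\<dots> < e" using nc md by simp
  finally show "\<exists>n c. N (\<lambda>t. x t + y t - (\<Sum>i<n. c i * w i t)) < e" by blast
qed

lemma W_scale:
  assumes x: "x \<in> W"
  shows "(\<lambda>t. a * x t) \<in> W"
proof (rule W_intro[OF scale[OF W_in[OF x]]])
  fix e :: real assume e: "0 < e"
  \<comment> \<open>The added 1 keeps the denominator positive when \<open>a = 0\<close>.\<close>
  obtain n c where nc: "N (\<lambda>t. x t - (\<Sum>i<n. c i * w i t)) < e / (norm a + 1)"
    using W_approx[OF x, of "e / (norm a + 1)"] e by (force simp: add_nonneg_pos)
  have "N (\<lambda>t. a * x t - (\<Sum>i<n. a * c i * w i t)) = N (\<lambda>t. a * (x t - (\<Sum>i<n. c i * w i t)))"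
    by (simp add: right_diff_distrib sum_distrib_left mult.assoc)
  also have "\<dots> = norm a * N (\<lambda>t. x t - (\<Sum>i<n. c i * w i t))"
    by (intro norm_scale diff W_in x span_in)
  also have "\<dots> \<le> (norm a + 1) * N (\<lambda>t. x t - (\<Sum>i<n. c i * w i t))"
    by (intro mult_right_mono N_nonneg diff W_in x span_in) auto
  also have "\<dots> < e" using nc by (simp add: pos_less_divide_eq add_nonneg_pos mult.commute)
  finally show "\<exists>n c. N (\<lambda>t. a * x t - (\<Sum>i<n. c i * w i t)) < e"
    by (intro exI[of _ n] exI[of _ "\<lambda>i. a * c i"])
qed

lemma W_sum:
  assumes "finite I" "\<And>i. i \<in> I \<Longrightarrow> x i \<in> W"
  shows "(\<lambda>t. \<Sum>i\<in>I. x i t) \<in> W"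
  using assms
proof (induction I rule: finite_induct)
  case empty
  then show ?case using span_in_W[where n = 0] by simp
next
  case (insert i I)
  then show ?case by (simp add: W_add)
qed

text \<open>A multiplier constant on each \<open>A i\<close> acts diagonally on the
  \<open>w i\<close>, so it preserves finite combinations; being contractive on \<open>X\<close>, it
  preserves their closure. It serves both for sign changes and for truncations.\<close>

lemma W_mult:
  assumes x: "x \<in> W"
    and a: "a \<in> borel_measurable M" "\<And>t. t \<in> space M \<Longrightarrow> norm (a t) \<le> 1"
    and eigen: "\<And>i t. t \<in> A i \<Longrightarrow> a t = \<alpha> i"
  shows "(\<lambda>t. a t * x t) \<in> W"
proof (rule W_intro[OF mult_bounded(1)[OF W_in[OF x] a]])
  fix e :: real assume "0 < e"
  then obtain n c where nc: "N (\<lambda>t. x t - (\<Sum>i<n. c i * w i t)) < e" using W_approx[OF x] by blast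
  let ?d = "\<lambda>t. x t - (\<Sum>i<n. c i * w i t)"
  have d: "?d \<in> X" by (intro diff W_in x span_in)
  have "AE t in M. a t * x t - (\<Sum>i<n. c i * \<alpha> i * w i t) = a t * ?d t"
    using AE_w
  proof eventually_elim
    case (elim t)
    have "c i * \<alpha> i * w i t = a t * (c i * w i t)" for i
      using elim eigen by (cases "t \<in> A i") auto
    then have "(\<Sum>i<n. c i * \<alpha> i * w i t) = (\<Sum>i<n. a t * (c i * w i t))"
      by (intro sum.cong refl)
    then show ?case by (simp add: right_diff_distrib sum_distrib_left)
  qed
  then have "N (\<lambda>t. a t * x t - (\<Sum>i<n. c i * \<alpha> i * w i t)) = N (\<lambda>t. a t * ?d t)"
    by (intro N_AE_cong mult_bounded(1)[OF d a] diff mult_bounded(1)[OF W_in[OF x] a] span_in)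
  also have "\<dots> < e" using mult_bounded(2)[OF d a] nc by simp
  finally show "\<exists>n c. N (\<lambda>t. a t * x t - (\<Sum>i<n. c i * w i t)) < e"
    by (intro exI[of _ n] exI[of _ "\<lambda>i. c i * \<alpha> i"])
qed

text \<open>The approximating combinations vanish off the supports, and restriction to the
  complement does not increase the norm.\<close>

lemma W_off:
  assumes x: "x \<in> W"
  shows "AE t in M. t \<notin> (\<Union>i. A i) \<longrightarrow> x t = 0"
proof -
  define B where "B = space M - (\<Union>i. A i)"
  have B: "B \<in> sets M" using A_sets by (auto simp: B_def)
  let ?y = "\<lambda>t. indicator B t * x t"
  have y: "?y \<in> X" by (intro indicator_in W_in x B)
  have "N ?y \<le> e" if "0 < e" for e
  proof -
    obtain n c where nc: "N (\<lambda>t. x t - (\<Sum>i<n. c i * w i t)) < e" using W_approx[OF x \<open>0 < e\<close>] by blast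
    have d: "(\<lambda>t. x t - (\<Sum>i<n. c i * w i t)) \<in> X" by (intro diff W_in x span_in)
    have "N ?y = N (\<lambda>t. indicator B t * (x t - (\<Sum>i<n. c i * w i t)))"
    proof (rule N_AE_cong[OF y indicator_in(1)[OF d B]])
      show "AE t in M. indicator B t * x t = indicator B t * (x t - (\<Sum>i<n. c i * w i t))"
        using AE_w
      proof eventually_elim
        case (elim t)
        have "(\<Sum>i<n. c i * w i t) = 0" if "t \<in> B"
          using elim that by (intro sum.neutral) (auto simp: B_def)
        then show ?case by (cases "t \<in> B") auto
      qed
    qed
    then show ?thesis using indicator_in(2)[OF d B] nc by simp
  qed
  then have "N ?y \<le> 0" by (meson dense not_less)
  then have "AE t in M. indicator B t * x t = 0"
    using N_nonneg[OF y] norm_eq_zero[OF y] by simp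
  then show ?thesis using AE_space by eventually_elim (auto simp: B_def indicator_def)
qed

text \<open>The line through \<open>w n\<close> is closed. Restricting approximants of
  \<open>x\<close> to \<open>A n\<close> yields multiples of \<open>w n\<close>; since
  \<open>N (w n) > 0\<close>, their coefficients form a Cauchy sequence in the scalar field.\<close>

lemma W_coefficient:
  assumes x: "x \<in> W"
  shows "\<exists>c. AE t in M. indicator (A n) t * x t = c * w n t"
proof -
  let ?y = "\<lambda>t. indicator (A n) t * x t"
  have y: "?y \<in> X" by (intro indicator_in W_in x A_sets)
  have "N (w n) \<noteq> 0" using norm_eq_zero[OF w_in] w_nonzero by simp
  then have pos: "0 < N (w n)" using N_nonneg[OF w_in, of n] by simp
  have dist_in: "(\<lambda>t. ?y t - d * w n t) \<in> X" for d by (intro diff y scale w_in)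
  have "\<exists>d. N (\<lambda>t. ?y t - d * w n t) < e" if "0 < e" for e
  proof -
    obtain m c where mc: "N (\<lambda>t. x t - (\<Sum>i<m. c i * w i t)) < e" using W_approx[OF x \<open>0 < e\<close>] by blast
    let ?s = "\<lambda>t. \<Sum>i<m. c i * w i t"
    \<comment> \<open>The default 0 covers an approximating sum that stops before the index
      \<open>n\<close>.\<close>
    define d where "d = (if n < m then c n else 0)"
    have s: "(\<lambda>t. x t - ?s t) \<in> X" by (intro diff W_in x span_in)
    have "AE t in M. ?y t - d * w n t = indicator (A n) t * (x t - ?s t)"
      using AE_w
    proof eventually_elim
      case (elim t)
      have "?s t = d * w n t" if "t \<in> A n"
      proof -
        have "?s t = (\<Sum>i<m. if i = n then d * w n t else 0)"
          using elim that A_eq by (intro sum.cong) (auto simp: d_def)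
        then show ?thesis by (simp add: d_def)
      qed
      then show ?case using elim by (cases "t \<in> A n") auto
    qed
    then have "N (\<lambda>t. ?y t - d * w n t) = N (\<lambda>t. indicator (A n) t * (x t - ?s t))"
      by (rule N_AE_cong[OF dist_in indicator_in(1)[OF s A_sets]])
    then show ?thesis using indicator_in(2)[OF s A_sets, of n] mc by (intro exI[of _ d]) simp
  qed
  then have "\<exists>d. N (\<lambda>t. ?y t - d * w n t) < inverse (real (Suc j))" for j by simp
  then obtain d where d: "\<And>j. N (\<lambda>t. ?y t - d j * w n t) < inverse (real (Suc j))" by metis
  have shift: "norm (a - b) * N (w n) \<le> N (\<lambda>t. ?y t - a * w n t) + N (\<lambda>t. ?y t - b * w n t)" for a b
  proof -
    have "norm (a - b) * N (w n) = N (\<lambda>t. (?y t - b * w n t) - (?y t - a * w n t))"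
      using norm_scale[OF w_in, of "a - b" n] by (simp add: algebra_simps)
    then show ?thesis using N_diff[OF dist_in dist_in, of b a] by simp
  qed
  have "Cauchy d"
  proof (rule CauchyI)
    fix e :: real assume "0 < e"
    then obtain k where k: "inverse (real (Suc k)) < e * N (w n) / 2"
      using reals_Archimedean[of "e * N (w n) / 2"] pos by auto
    have "norm (d i - d j) < e" if "k \<le> i" "k \<le> j" for i j
    proof -
      have "inverse (real (Suc i)) \<le> inverse (real (Suc k))"
        "inverse (real (Suc j)) \<le> inverse (real (Suc k))" using that by auto
      then have "norm (d i - d j) * N (w n) < e * N (w n)"
        using shift[of "d i" "d j"] d[of i] d[of j] k by linarith
      then show ?thesis using pos by simp
    qed
    then show "\<exists>k. \<forall>i\<ge>k. \<forall>j\<ge>k. norm (d i - d j) < e" by blast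
  qed
  then obtain c where c: "d \<longlonglongrightarrow> c" using Cauchy_convergent convergent_def by blast
  have "N (\<lambda>t. ?y t - c * w n t) \<le> inverse (real (Suc j)) + norm (d j - c) * N (w n)" for j
  proof -
    have "N (\<lambda>t. ?y t - c * w n t) = N (\<lambda>t. (?y t - d j * w n t) + (d j - c) * w n t)"
      by (simp add: algebra_simps)
    also have "\<dots> \<le> N (\<lambda>t. ?y t - d j * w n t) + norm (d j - c) * N (w n)"
      using norm_triangle[OF dist_in scale[OF w_in], of "d j" "d j - c" n]
        norm_scale[OF w_in, of "d j - c" n] by simp
    finally show ?thesis using d[of j] by simp
  qed
  moreover have "(\<lambda>j. inverse (real (Suc j)) + norm (d j - c) * N (w n)) \<longlonglongrightarrow> 0 + norm (c - c) * N (w n)"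
    by (intro tendsto_intros LIMSEQ_inverse_real_of_nat c)
  ultimately have "N (\<lambda>t. ?y t - c * w n t) \<le> 0" by (intro LIMSEQ_le_const) auto
  then have "AE t in M. ?y t - c * w n t = 0"
    using norm_eq_zero[OF dist_in] N_nonneg[OF dist_in, of c] by simp
  then show ?thesis by (intro exI[of _ c]) simp
qed

text \<open>Turns a truncated element of the closed span into a finite combination, where linearity
  of \<open>l\<close> can be applied.\<close>

lemma W_truncate:
  assumes x: "x \<in> W"
  obtains c where "AE t in M. indicator (\<Union>i<m. A i) t * x t = (\<Sum>i<m. c i * w i t)"
proof -
  obtain c where "\<And>n. AE t in M. indicator (A n) t * x t = c n * w n t"
    using W_coefficient[OF x] by metis
  then have "AE t in M. \<forall>n. indicator (A n) t * x t = c n * w n t" by (simp add: AE_all_countable)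
  then have "AE t in M. indicator (\<Union>i<m. A i) t * x t = (\<Sum>i<m. c i * w i t)"
    by eventually_elim (simp add: indicator_UN_sum[OF A_disjoint])
  then show thesis by (rule that)
qed

end

text \<open>The given supports may overlap in null sets. Removing from each support the earlier ones
  makes them disjoint and discards only null sets.\<close>

lemma disjoint_sequence_vectors:
  assumes "koethe_function_space M X N" "disjoint_sequence M X w"
  obtains A where "disjoint_vectors M X N w A"
proof -
  interpret koethe_function_space M X N by fact
  define S where "S n = support_on (space M) (w n)" for n
  have w: "\<And>n. w n \<in> X" "\<And>n. \<not> (AE t in M. w n t = 0)"
    and disj: "\<And>m n. m \<noteq> n \<Longrightarrow> AE t in M. t \<notin> S m \<inter> S n"
    using assms(2) by (auto simp: disjoint_sequence_def S_def)
  have S: "S n \<in> sets M" for n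
  proof -
    have [measurable]: "w n \<in> borel_measurable M" using w(1) by (rule in_borel)
    have "S n = {t \<in> space M. w n t \<noteq> 0}" by (auto simp: S_def support_on_def)
    then show ?thesis by simp
  qed
  have "AE t in M. \<forall>m n. m \<noteq> n \<longrightarrow> t \<notin> S m \<inter> S n"
    using disj by (auto simp: AE_all_countable)
  then have "AE t in M. t \<notin> disjointed S n \<longrightarrow> w n t = 0" for n
    using AE_space
  proof eventually_elim
    case (elim t)
    \<comment> \<open>Outside one null set a point lies in at most one support, so no earlier
      support removes it from the \<open>n\<close>-th.\<close>
    then have "k = n" if "w k t \<noteq> 0" "w n t \<noteq> 0" for k
      using that by (auto simp: S_def support_on_def)
    then show ?case using elim(2) by (force simp: disjointed_def S_def support_on_def)
  qed
  moreover have "w n t \<noteq> 0" if "t \<in> disjointed S n" for n t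
    using that disjointed_subset[of S n] by (auto simp: S_def support_on_def)
  moreover have "disjointed S n \<in> sets M" for n
    using S sets.range_disjointed_sets[of S M] by blast
  ultimately have "disjoint_vectors M X N w (disjointed S)"
    by unfold_locales (auto simp: w disjoint_family_disjointed)
  then show thesis by (rule that)
qed

section \<open>Averaging over sign changes\<close>

lemma exact_sign:
  assumes "exact M X \<Omega>" "x \<in> X" "u \<in> borel_measurable M" "\<And>t. u t = 1 \<or> u t = - 1"
  shows "AE t in M. \<Omega> (\<lambda>s. u s * x s) t = u t * \<Omega> x t"
proof -
  have "norm (u t) \<le> 1" for t using assms(4)[of t] by auto
  then have "u \<in> Linfty M" using assms(3) by (intro Linfty_bounded)
  then show ?thesis using assms by (simp add: exact_def)
qed

text \<open>Changing the sign exactly where \<open>x\<close> vanishes leaves \<open>x\<close>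
  unchanged, so exactness makes \<open>\<Omega> x\<close> equal to its own negative there.\<close>

lemma (in koethe_function_space) exact_supp:
  assumes "exact M X \<Omega>" and x: "x \<in> X"
  shows "AE t in M. x t = 0 \<longrightarrow> \<Omega> x t = 0"
proof -
  have [measurable]: "x \<in> borel_measurable M" using x by (rule in_borel)
  define u :: "'a \<Rightarrow> 'k" where "u t = (if x t = 0 then - 1 else 1)" for t
  have "u \<in> borel_measurable M" unfolding u_def by measurable
  then have "AE t in M. \<Omega> (\<lambda>s. u s * x s) t = u t * \<Omega> x t"
    by (rule exact_sign[OF assms]) (simp add: u_def)
  moreover have "(\<lambda>s. u s * x s) = x" by (auto simp: u_def)
  ultimately have "AE t in M. \<Omega> x t = u t * \<Omega> x t" by simp
  then show ?thesis
    by eventually_elim (auto simp: u_def eq_neg_iff_add_eq_0 simp flip: mult_2)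
qed

lemma linear_into_L0D:
  assumes "linear_into_L0 M V l"
  shows "x \<in> V \<Longrightarrow> l x \<in> borel_measurable M"
    and "x \<in> V \<Longrightarrow> y \<in> V \<Longrightarrow> AE t in M. x t = y t \<Longrightarrow> AE t in M. l x t = l y t"
    and "x \<in> V \<Longrightarrow> y \<in> V \<Longrightarrow> AE t in M. l (\<lambda>s. x s + y s) t = l x t + l y t"
    and "x \<in> V \<Longrightarrow> AE t in M. l (\<lambda>s. c * x s) t = c * l x t"
  using assms by (auto simp: linear_into_L0_def)

context disjoint_vectors
begin

lemma linear_span:
  assumes l: "linear_into_L0 M W l"
  shows "AE t in M. l (\<lambda>s. \<Sum>i<m. c i * w i s) t = (\<Sum>i<m. c i * l (w i) t)"
proof (induction m)
  case 0
  \<comment> \<open>The empty sum is treated as a zero multiple of \<open>w 0\<close>, so that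
    homogeneity determines its image.\<close>
  have "AE t in M. l (\<lambda>s. 0 * w 0 s) t = 0 * l (w 0) t"
    by (rule linear_into_L0D(4)[OF l w_in_W])
  then show ?case by simp
next
  case (Suc m)
  show ?case
    using Suc linear_into_L0D(4)[OF l w_in_W[of m], of "c m"]
      linear_into_L0D(3)[OF l span_in_W[where n = m and c = c] W_scale[OF w_in_W[of m], of "c m"]]
    by eventually_elim simp
qed

text \<open>One sign change per support. Averaging successively over \<open>flip 0\<close>, ...,
  \<open>flip (m - 1)\<close> amounts to averaging over all sign patterns on the first
  \<open>m\<close> supports.\<close>

definition flip :: "nat \<Rightarrow> 'a \<Rightarrow> 'k" where
  "flip m t = (if t \<in> A m then - 1 else 1)"

lemma flip_measurable [measurable]: "flip m \<in> borel_measurable M"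
proof -
  have [measurable]: "A m \<in> sets M" by (rule A_sets)
  show ?thesis unfolding flip_def[abs_def] by measurable
qed

lemma norm_flip: "norm (flip m t) \<le> 1"
  by (simp add: flip_def)

lemma flip_square: "flip m t * flip m t = 1"
  by (simp add: flip_def)

lemma flip_in_W: "x \<in> W \<Longrightarrow> (\<lambda>t. flip m t * x t) \<in> W"
  using A_eq
  by (intro W_mult[where \<alpha> = "\<lambda>i. if i = m then - 1 else 1"] norm_flip flip_measurable)
    (auto simp: flip_def)

text \<open>The average of \<open>l\<close> and its conjugate by \<open>flip m\<close> stays as close to \<open>\<Omega>\<close> as \<open>l\<close>
  is, because an exact \<open>\<Omega>\<close> commutes with \<open>flip m\<close>. On \<open>A m\<close> the average kills the images of the
  \<open>w k\<close> with \<open>k \<noteq> m\<close>.\<close>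

lemma linear_averaging:
  assumes cent: "centralizer M X N \<Omega>" and ex: "exact M X \<Omega>"
    and l: "linear_into_L0 M W l"
    and C: "0 \<le> C" "\<And>x. x \<in> W \<Longrightarrow> (\<lambda>t. \<Omega> x t - l x t) \<in> X \<and> N (\<lambda>t. \<Omega> x t - l x t) \<le> C * N x"
  shows "\<exists>l'. linear_into_L0 M W l' \<and>
    (\<forall>x\<in>W. (\<lambda>t. \<Omega> x t - l' x t) \<in> X \<and> N (\<lambda>t. \<Omega> x t - l' x t) \<le> C * N x) \<and>
    (AE t in M. \<forall>i k. t \<in> A i \<longrightarrow> (k = i \<longrightarrow> l' (w k) t = l (w k) t) \<and>
      (k \<noteq> i \<and> i < m \<longrightarrow> l' (w k) t = 0))"
proof (induction m)
  case 0
  then show ?case using l C(2) by (intro exI[of _ l]) auto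
next
  case (Suc m)
  then obtain l' where l': "linear_into_L0 M W l'"
    and bound: "\<And>x. x \<in> W \<Longrightarrow> (\<lambda>t. \<Omega> x t - l' x t) \<in> X"
      "\<And>x. x \<in> W \<Longrightarrow> N (\<lambda>t. \<Omega> x t - l' x t) \<le> C * N x"
    and diag: "AE t in M. \<forall>i k. t \<in> A i \<longrightarrow> (k = i \<longrightarrow> l' (w k) t = l (w k) t) \<and>
      (k \<noteq> i \<and> i < m \<longrightarrow> l' (w k) t = 0)"
    by auto
  let ?f = "\<lambda>x s. flip m s * x s"
  define l'' where "l'' x t = (l' x t + flip m t * l' (?f x) t) / 2" for x t
  have "linear_into_L0 M W l''"
    unfolding linear_into_L0_def
  proof (intro conjI ballI allI impI)
    fix x assume x: "x \<in> W"
    have [measurable]: "l' x \<in> borel_measurable M" "l' (?f x) \<in> borel_measurable M"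
      using x flip_in_W by (auto intro: linear_into_L0D(1)[OF l'])
    show "l'' x \<in> borel_measurable M" unfolding l''_def[abs_def] by measurable
    show "AE t in M. l'' (\<lambda>s. c * x s) t = c * l'' x t" for c
    proof -
      have eq: "l'' (\<lambda>s. c * x s) t = (l' (\<lambda>s. c * x s) t + flip m t * l' (\<lambda>s. c * ?f x s) t) / 2" for t
        unfolding l''_def by (simp only: mult.left_commute)
      show ?thesis
        using linear_into_L0D(4)[OF l' x, of c] linear_into_L0D(4)[OF l' flip_in_W[OF x, of m], of c]
        by eventually_elim (simp only: eq, simp add: l''_def algebra_simps)
    qed
    fix y assume y: "y \<in> W"
    show "AE t in M. l'' (\<lambda>s. x s + y s) t = l'' x t + l'' y t"
      using linear_into_L0D(3)[OF l' x y] linear_into_L0D(3)[OF l' flip_in_W[OF x, of m] flip_in_W[OF y, of m]]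
      by eventually_elim (simp add: l''_def distrib_left add_divide_distrib)
    assume eq: "AE t in M. x t = y t"
    then have "AE t in M. ?f x t = ?f y t" by eventually_elim simp
    from linear_into_L0D(2)[OF l' flip_in_W[OF x] flip_in_W[OF y] this] linear_into_L0D(2)[OF l' x y eq]
    show "AE t in M. l'' x t = l'' y t" by eventually_elim (simp add: l''_def)
  qed
  moreover have "(\<lambda>t. \<Omega> x t - l'' x t) \<in> X \<and> N (\<lambda>t. \<Omega> x t - l'' x t) \<le> C * N x"
    if x: "x \<in> W" for x
  proof -
    note fx = flip_in_W[OF x, of m]
    let ?d = "\<lambda>t. \<Omega> x t - l' x t" and ?e = "\<lambda>t. \<Omega> (?f x) t - l' (?f x) t"
    let ?a = "\<lambda>t. (1 / 2) * (?d t + flip m t * ?e t)"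
    have e: "(\<lambda>t. flip m t * ?e t) \<in> X" "N (\<lambda>t. flip m t * ?e t) \<le> N ?e"
      by (intro mult_bounded bound fx norm_flip flip_measurable)+
    have a: "?a \<in> X" by (intro scale add bound x e)
    have "N ?e \<le> C * N (?f x)" by (rule bound(2)[OF fx])
    also have "\<dots> \<le> C * N x"
      by (intro mult_left_mono C(1) mult_bounded(2)[OF W_in[OF x]] norm_flip flip_measurable)
    finally have e_le: "N ?e \<le> C * N x" .
    have "N ?a = (1 / 2) * N (\<lambda>t. ?d t + flip m t * ?e t)"
      using norm_scale[OF add[OF bound(1)[OF x] e(1)], of "1 / 2"] by (simp add: norm_divide)
    also have "\<dots> \<le> C * N x"
      using norm_triangle[OF bound(1)[OF x] e(1)] bound(2)[OF x] e(2) e_le by simp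
    finally have Na: "N ?a \<le> C * N x" .
    have "AE t in M. \<Omega> (?f x) t = flip m t * \<Omega> x t"
      by (rule exact_sign[OF ex W_in[OF x] flip_measurable]) (simp add: flip_def)
    then have eq: "AE t in M. \<Omega> x t - l'' x t = ?a t"
      by eventually_elim (simp add: l''_def flip_square right_diff_distrib field_simps)
    have [measurable]: "\<Omega> x \<in> borel_measurable M" "l' x \<in> borel_measurable M"
      "l' (?f x) \<in> borel_measurable M"
      using cent W_in[OF x] x fx linear_into_L0D(1)[OF l'] by (auto simp: centralizer_def)
    have "(\<lambda>t. \<Omega> x t - l'' x t) \<in> borel_measurable M" unfolding l''_def by measurable
    from AE_eq_in[OF a this eq] Na show ?thesis by simp
  qed
  moreover have "AE t in M. \<forall>i k. t \<in> A i \<longrightarrow> (k = i \<longrightarrow> l'' (w k) t = l (w k) t) \<and>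
      (k \<noteq> i \<and> i < Suc m \<longrightarrow> l'' (w k) t = 0)"
  proof -
    \<comment> \<open>\<open>\<sigma> k\<close> is the eigenvalue of \<open>flip m\<close> at
      \<open>w k\<close>, and also the constant value of \<open>flip m\<close> on
      \<open>A k\<close>.\<close>
    define \<sigma> :: "nat \<Rightarrow> 'k" where "\<sigma> k = (if k = m then - 1 else 1)" for k
    have "AE t in M. l' (?f (w k)) t = \<sigma> k * l' (w k) t" for k
    proof -
      have "AE t in M. ?f (w k) t = \<sigma> k * w k t"
        using AE_w by eventually_elim (use A_eq in \<open>auto simp: flip_def \<sigma>_def\<close>)
      from linear_into_L0D(2)[OF l' flip_in_W[OF w_in_W] W_scale[OF w_in_W] this]
        linear_into_L0D(4)[OF l' w_in_W[of k], of "\<sigma> k"]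
      show ?thesis by eventually_elim simp
    qed
    then have "AE t in M. \<forall>k. l' (?f (w k)) t = \<sigma> k * l' (w k) t" by (simp add: AE_all_countable)
    with diag show ?thesis
    proof eventually_elim
      case (elim t)
      \<comment> \<open>The factor is 0 when exactly one of \<open>i\<close> and \<open>k\<close>
        equals \<open>m\<close>, and 1 otherwise. So the diagonal and the zeros already obtained
        survive, and the entries on \<open>A m\<close> with \<open>k \<noteq> m\<close>
        disappear.\<close>
      have avg: "l'' (w k) t = (1 + \<sigma> i * \<sigma> k) / 2 * l' (w k) t" if i: "t \<in> A i" for i k
      proof -
        have "flip m t = \<sigma> i" using i A_eq by (auto simp: flip_def \<sigma>_def)
        then show ?thesis using elim(2) by (simp add: l''_def algebra_simps add_divide_distrib)
      qed
      have "l'' (w i) t = l (w i) t" if i: "t \<in> A i" for i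
      proof -
        have "\<sigma> i * \<sigma> i = 1" by (simp add: \<sigma>_def)
        then show ?thesis using avg[OF i, of i] elim(1) i by simp
      qed
      moreover have "l'' (w k) t = 0" if i: "t \<in> A i" "k \<noteq> i" "i < Suc m" for i k
      proof (cases "i = m")
        case True
        then have "\<sigma> i * \<sigma> k = - 1" using i by (simp add: \<sigma>_def)
        then show ?thesis using avg[OF i(1), of k] by simp
      next
        case False
        then have "l' (w k) t = 0" using elim(1) i by simp
        then show ?thesis using avg[OF i(1), of k] by simp
      qed
      ultimately show ?case by blast
    qed
  qed
  ultimately show ?case by blast
qed

text \<open>The constant obtained is \<open>C + D\<close>, where \<open>C\<close> bounds the
  distance from \<open>\<Omega>\<close> to \<open>l\<close> and \<open>D\<close> is the centralizer
  constant for multipliers bounded by one. Neither depends on the length of the truncation, so the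
  Fatou property applies.\<close>

lemma near_multiplication:
  assumes X_refl: "reflexive X N"
    and cent: "centralizer M X N \<Omega>" and ex: "exact M X \<Omega>"
    and triv: "trivial_on M X N \<Omega> W"
  obtains h K where "h \<in> borel_measurable M" "0 \<le> K"
    "\<And>x. x \<in> W \<Longrightarrow> (\<lambda>t. \<Omega> x t - h t * x t) \<in> X \<and> N (\<lambda>t. \<Omega> x t - h t * x t) \<le> K * N x"
proof -
  obtain l C' where l: "linear_into_L0 M W l"
    and C': "\<And>x. x \<in> W \<Longrightarrow> (\<lambda>t. \<Omega> x t - l x t) \<in> X \<and> N (\<lambda>t. \<Omega> x t - l x t) \<le> C' * N x"
    using triv by (auto simp: trivial_on_def)
  define C where "C = \<bar>C'\<bar>"
  have C: "0 \<le> C" "\<And>x. x \<in> W \<Longrightarrow> (\<lambda>t. \<Omega> x t - l x t) \<in> X \<and> N (\<lambda>t. \<Omega> x t - l x t) \<le> C * N x"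
    using C' mult_right_mono[OF abs_ge_self N_nonneg[OF W_in]] by (auto simp: C_def intro: order_trans)
  \<comment> \<open>At each point at most one term of the series is nonzero; off the sets
    \<open>A n\<close> the value is 0.\<close>
  define h where "h t = (\<Sum>n. indicator (A n) t * (l (w n) t / w n t))" for t
  have [measurable]: "A n \<in> sets M" "w n \<in> borel_measurable M" "l (w n) \<in> borel_measurable M" for n
    using A_sets in_borel[OF w_in] linear_into_L0D(1)[OF l w_in_W] by auto
  have h_meas [measurable]: "h \<in> borel_measurable M" unfolding h_def[abs_def] by measurable
  have h_on: "h t * w n t = l (w n) t" if t: "t \<in> A n" for n t
  proof -
    have "h t = (\<Sum>k\<in>{n}. indicator (A k) t * (l (w k) t / w k t))"
      unfolding h_def using t A_eq by (intro suminf_finite) (auto simp: indicator_def)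
    then show ?thesis using t w_on[OF t] by simp
  qed
  define B where "B m = (\<Union>i<m. A i)" for m
  have B [measurable]: "B m \<in> sets M" for m by (auto simp: B_def)
  have B_W: "(\<lambda>t. indicator (B m) t * x t) \<in> W" if "x \<in> W" for x m
    using that A_eq
    by (intro W_mult[where \<alpha> = "\<lambda>i. if i < m then 1 else 0"]) (auto simp: B_def indicator_def)
  have finite_case: "(\<lambda>t. \<Omega> y t - h t * y t) \<in> X \<and> N (\<lambda>t. \<Omega> y t - h t * y t) \<le> C * N y"
    if x: "x \<in> W" and y_def: "y = (\<lambda>t. indicator (B m) t * x t)" for x y m
  proof -
    have y: "y \<in> W" using B_W[OF x] y_def by simp
    obtain c where c: "AE t in M. y t = (\<Sum>i<m. c i * w i t)"
      using W_truncate[OF x, of m] by (auto simp: y_def B_def)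
    \<comment> \<open>This map depends on \<open>m\<close>, but its diagonal entries are those of
      \<open>l\<close>, from which \<open>h\<close> was built.\<close>
    obtain l' where l': "linear_into_L0 M W l'"
      and bound: "\<forall>x\<in>W. (\<lambda>t. \<Omega> x t - l' x t) \<in> X \<and> N (\<lambda>t. \<Omega> x t - l' x t) \<le> C * N x"
      and diag: "AE t in M. \<forall>i k. t \<in> A i \<longrightarrow> (k = i \<longrightarrow> l' (w k) t = l (w k) t) \<and>
        (k \<noteq> i \<and> i < m \<longrightarrow> l' (w k) t = 0)"
      using linear_averaging[OF cent ex l C] by blast
    \<comment> \<open>On \<open>A i\<close> with \<open>i < m\<close> the averaged map acts on the
      \<open>w k\<close> as multiplication by \<open>h\<close>. Off \<open>B m\<close> both sides
      vanish, on the left by \<open>exact_supp\<close>.\<close>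
    have eq: "AE t in M. \<Omega> y t - h t * y t = indicator (B m) t * (\<Omega> y t - l' y t)"
      using c linear_into_L0D(2)[OF l' y span_in_W c] linear_span[OF l', where m = m and c = c]
        diag AE_w exact_supp[OF ex W_in[OF y]]
    proof eventually_elim
      case (elim t)
      show ?case
      proof (cases "t \<in> B m")
        case False
        then show ?thesis using elim by (simp add: y_def)
      next
        case True
        then obtain i where i: "i < m" "t \<in> A i" by (auto simp: B_def)
        have "l' (w k) t = h t * w k t" for k
        proof (cases "k = i")
          case True
          then show ?thesis using elim(4) i h_on[OF i(2)] by auto
        next
          case False
          then have "t \<notin> A k" using A_eq i by auto
          then show ?thesis using elim(4,5) i False by auto
        qed
        then have "l' y t = h t * y t"
          using elim(1-3) by (simp add: sum_distrib_left mult.left_commute)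
        then show ?thesis using True by simp
      qed
    qed
    have meas: "(\<lambda>t. \<Omega> y t - h t * y t) \<in> borel_measurable M"
    proof -
      have [measurable]: "\<Omega> y \<in> borel_measurable M" "y \<in> borel_measurable M"
        using cent W_in[OF y] in_borel by (auto simp: centralizer_def)
      show ?thesis by measurable
    qed
    have d: "(\<lambda>t. \<Omega> y t - l' y t) \<in> X" "N (\<lambda>t. \<Omega> y t - l' y t) \<le> C * N y"
      using bound y by auto
    note result = AE_eq_in[OF indicator_in(1)[OF d(1) B] meas eq]
    show ?thesis
      using result(1) order_trans[OF eq_refl[OF result(2)] order_trans[OF indicator_in(2)[OF d(1) B] d(2)]]
      by (rule conjI)
  qed
  obtain D where D: "0 \<le> D" "\<And>a x. a \<in> borel_measurable M \<Longrightarrow> (\<And>t. t \<in> space M \<Longrightarrow> norm (a t) \<le> 1) \<Longrightarrow>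
    x \<in> X \<Longrightarrow> (\<lambda>t. \<Omega> (\<lambda>s. a s * x s) t - a t * \<Omega> x t) \<in> X \<and>
      N (\<lambda>t. \<Omega> (\<lambda>s. a s * x s) t - a t * \<Omega> x t) \<le> D * N x"
    using centralizer_bounded[OF cent] by blast
  show thesis
  proof (rule that[OF h_meas])
    show "0 \<le> C + D" using C D by simp
    fix x assume x: "x \<in> W"
    let ?y = "\<lambda>t. \<Omega> x t - h t * x t"
    have [measurable]: "\<Omega> x \<in> borel_measurable M" "x \<in> borel_measurable M"
      using cent W_in[OF x] in_borel by (auto simp: centralizer_def)
    have y: "?y \<in> borel_measurable M" by measurable
    have cut: "(\<lambda>t. indicator (B m) t * ?y t) \<in> X \<and> N (\<lambda>t. indicator (B m) t * ?y t) \<le> (C + D) * N x" for m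
    proof -
      let ?x = "\<lambda>t. indicator (B m) t * x t"
      \<comment> \<open>The cut of \<open>\<Omega> x - h x\<close> is \<open>?p - ?q\<close>: the
        estimate for the truncated vector, corrected by the error of moving the indicator through
        \<open>\<Omega>\<close>.\<close>
      let ?p = "\<lambda>t. \<Omega> ?x t - h t * ?x t" and ?q = "\<lambda>t. \<Omega> ?x t - indicator (B m) t * \<Omega> x t"
      have p: "?p \<in> X" "N ?p \<le> C * N ?x" using finite_case[OF x refl] by auto
      have q: "?q \<in> X" "N ?q \<le> D * N x"
        using D(2)[of "indicator (B m)", OF _ _ W_in[OF x]] by (auto simp: indicator_def)
      have "C * N ?x \<le> C * N x"
        by (intro mult_left_mono indicator_in(2)[OF W_in[OF x] B] C)
      then have "N (\<lambda>t. ?p t - ?q t) \<le> (C + D) * N x"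
        using N_diff[OF p(1) q(1)] p(2) q(2) by (simp add: distrib_right)
      moreover have "(\<lambda>t. indicator (B m) t * ?y t) = (\<lambda>t. ?p t - ?q t)"
        by (auto simp: algebra_simps)
      ultimately show ?thesis using diff[OF p(1) q(1)] by simp
    qed
    \<comment> \<open>Off all supports \<open>x\<close> vanishes, hence so does
      \<open>\<Omega> x\<close>; the truncations therefore exhaust the whole function.\<close>
    have "AE t in M. ?y t = indicator (\<Union>i. A i) t * ?y t"
      using W_off[OF x] exact_supp[OF ex W_in[OF x]]
      by eventually_elim (auto simp: indicator_def)
    from reflexive_Fatou[OF X_refl y A_disjoint A_sets _ _ this, of "(C + D) * N x"] cut
    show "?y \<in> X \<and> N ?y \<le> (C + D) * N x" by (auto simp: B_def)
  qed
qed

end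

section \<open>Choice of the vectors \<open>z\<close>\<close>

theorem lemma4p3:
  fixes M :: "'a measure"
    and X :: "('a \<Rightarrow> 'k::{real_normed_field, euclidean_space}) set"
    and N :: "('a \<Rightarrow> 'k) \<Rightarrow> real"
    and \<Omega> :: "('a \<Rightarrow> 'k) \<Rightarrow> ('a \<Rightarrow> 'k)"
  assumes "koethe_function_space M X N"
    and "reflexive X N"
    and "centralizer M X N \<Omega>"
    and "exact M X \<Omega>"
    and "\<not> disjointly_singular M X N \<Omega>"
  shows "\<exists>W K. generated_by_disjoint_sequence M X N W \<and>
    (\<forall>(n::nat) (u :: nat \<Rightarrow> 'a \<Rightarrow> 'k). (\<forall>i\<in>{1..n}. u i \<in> W) \<longrightarrow>
      (\<exists>z :: nat \<Rightarrow> 'a \<Rightarrow> 'k.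
        (\<forall>i\<in>{1..n}. z i \<in> X \<and>
           (AE t in M. t \<in> support_on (space M) (z i) \<longrightarrow> t \<in> support_on (space M) (u i)) \<and>
           N (z i) \<le> K * N (u i)) \<and>
        (\<forall>c :: nat \<Rightarrow> 'k.
           (\<lambda>t. \<Omega> (\<lambda>s. \<Sum>i=1..n. c i * u i s) t - (\<Sum>i=1..n. c i * \<Omega> (u i) t)) \<in> X \<and>
           N (\<lambda>t. \<Omega> (\<lambda>s. \<Sum>i=1..n. c i * u i s) t - (\<Sum>i=1..n. c i * \<Omega> (u i) t))
             \<le> K * (N (\<lambda>t. \<Sum>i=1..n. c i * u i t) + N (\<lambda>t. \<Sum>i=1..n. c i * z i t)))))"
proof -
  obtain w where w: "disjoint_sequence M X w"
    and triv: "trivial_on M X N \<Omega> (closed_linear_span X N w)"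
    using assms(5) by (auto simp: disjointly_singular_def generated_by_disjoint_sequence_def)
  obtain A where "disjoint_vectors M X N w A"
    using disjoint_sequence_vectors[OF assms(1) w] by blast
  then interpret disjoint_vectors M X N w A .
  obtain h K0 where h: "h \<in> borel_measurable M" "0 \<le> K0"
    and K0: "\<And>x. x \<in> W \<Longrightarrow> (\<lambda>t. \<Omega> x t - h t * x t) \<in> X \<and> N (\<lambda>t. \<Omega> x t - h t * x t) \<le> K0 * N x"
    using near_multiplication[OF assms(2-4) triv] by blast
  \<comment> \<open>The combination of the \<open>z i\<close> enters the final estimate with
    coefficient 1, so a common constant must be at least 1.\<close>
  define K where "K = max 1 K0"
  have near: "(\<lambda>t. \<Omega> x t - h t * x t) \<in> X" "N (\<lambda>t. \<Omega> x t - h t * x t) \<le> K * N x"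
    if x: "x \<in> W" for x
  proof -
    have "K0 * N x \<le> K * N x"
      using N_nonneg[OF W_in[OF x]] by (intro mult_right_mono) (auto simp: K_def)
    then show "(\<lambda>t. \<Omega> x t - h t * x t) \<in> X" "N (\<lambda>t. \<Omega> x t - h t * x t) \<le> K * N x"
      using K0[OF x] by auto
  qed
  show ?thesis
  proof (intro exI[of _ W] exI[of _ K] conjI allI impI)
    show "generated_by_disjoint_sequence M X N W"
      using w by (auto simp: generated_by_disjoint_sequence_def)
    fix n :: nat and u :: "nat \<Rightarrow> 'a \<Rightarrow> 'k" assume u: "\<forall>i\<in>{1..n}. u i \<in> W"
    define z where "z i t = \<Omega> (u i) t - h t * u i t" for i t
    have z: "z i \<in> X" "N (z i) \<le> K * N (u i)"
      "AE t in M. t \<in> support_on (space M) (z i) \<longrightarrow> t \<in> support_on (space M) (u i)"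
      if "i \<in> {1..n}" for i
    proof -
      have ui: "u i \<in> W" using u that by blast
      show "z i \<in> X" "N (z i) \<le> K * N (u i)" using near[OF ui] by (auto simp: z_def[abs_def])
      show "AE t in M. t \<in> support_on (space M) (z i) \<longrightarrow> t \<in> support_on (space M) (u i)"
        using exact_supp[OF assms(4) W_in[OF ui]]
        by eventually_elim (auto simp: support_on_def z_def)
    qed
    have main: "(\<lambda>t. \<Omega> (\<lambda>s. \<Sum>i=1..n. c i * u i s) t - (\<Sum>i=1..n. c i * \<Omega> (u i) t)) \<in> X \<and>
           N (\<lambda>t. \<Omega> (\<lambda>s. \<Sum>i=1..n. c i * u i s) t - (\<Sum>i=1..n. c i * \<Omega> (u i) t))
             \<le> K * (N (\<lambda>t. \<Sum>i=1..n. c i * u i t) + N (\<lambda>t. \<Sum>i=1..n. c i * z i t))" for c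
    proof -
      let ?s = "\<lambda>t. \<Sum>i=1..n. c i * u i t" and ?z = "\<lambda>t. \<Sum>i=1..n. c i * z i t"
      have s: "?s \<in> W" using u by (intro W_sum W_scale) auto
      have zX: "?z \<in> X" using z by (intro sum_in scale) auto
      \<comment> \<open>The terms containing \<open>h\<close> cancel, leaving the error at the
        combination minus the combination of the errors.\<close>
      have "(\<lambda>t. \<Omega> ?s t - (\<Sum>i=1..n. c i * \<Omega> (u i) t)) = (\<lambda>t. (\<Omega> ?s t - h t * ?s t) - ?z t)"
        by (simp add: z_def right_diff_distrib sum_subtractf sum_distrib_left mult.left_commute)
      moreover have "N (\<lambda>t. (\<Omega> ?s t - h t * ?s t) - ?z t) \<le> K * N ?s + N ?z"
        using N_diff[OF near(1)[OF s] zX] near(2)[OF s] by simp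
      moreover have "1 * N ?z \<le> K * N ?z"
        using N_nonneg[OF zX] by (intro mult_right_mono) (auto simp: K_def)
      ultimately show ?thesis using diff[OF near(1)[OF s] zX] by (simp add: distrib_left)
    qed
    show "\<exists>z. (\<forall>i\<in>{1..n}. z i \<in> X \<and>
           (AE t in M. t \<in> support_on (space M) (z i) \<longrightarrow> t \<in> support_on (space M) (u i)) \<and>
           N (z i) \<le> K * N (u i)) \<and>
        (\<forall>c :: nat \<Rightarrow> 'k.
           (\<lambda>t. \<Omega> (\<lambda>s. \<Sum>i=1..n. c i * u i s) t - (\<Sum>i=1..n. c i * \<Omega> (u i) t)) \<in> X \<and>
           N (\<lambda>t. \<Omega> (\<lambda>s. \<Sum>i=1..n. c i * u i s) t - (\<Sum>i=1..n. c i * \<Omega> (u i) t))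
             \<le> K * (N (\<lambda>t. \<Sum>i=1..n. c i * u i t) + N (\<lambda>t. \<Sum>i=1..n. c i * z i t)))"
      using z main by (intro exI[of _ z] conjI ballI allI) auto
  qed
qed

end
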